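(* Let $G$ be a finite simple disconnected graph with independence number five whose independence attractor $\mathscr{A}(G)$ is a line segment (in $\mathbb{C}$). Then $G$ has at most three connected components. Moreover: (1) When $G$ has three components, its independence polynomial has the decomposition $(1+z)(1+12z+16z^2)(1+12z+16z^2)$. (2) When $G$ has two components, its independence polynomial has one of the following decompositions: (a) $(1+12z+16z^2)(1+13z+28z^2+16z^3)$; (b) $(1+z)(1+24z+26z^2+9z^3+z^4)$; (c) $(1+z)(1+24z+76z^2+64z^3+16z^4)$; (d) $(1+z)(1+24z+126z^2+189z^3+81z^4)$; (e) $(1+z)(1+24z+176z^2+384z^3+256z^4)$. Furthermore, $\mathscr{A}(G)=[-1,0]$ if the decomposition of the independence polynomial is $(1+z)(1+12z+16z^2)(1+12z+16z^2)$, or $(1+12z+16z^2)(1+13z+28z^2+16z^3)$, or $(1+z)(1+24z+176z^2+384z^3+256z^4)$; $\mathscr{A}(G)=[-2,0]$ if the decomposition is $(1+z)(1+24z+76z^2+64z^3+16z^4)$; $\mathscr{A}(G)=[-4/3,0]$ if the decomposition is $(1+z)(1+24z+126z^2+189z^3+81z^4)$; and $\mathscr{A}(G)=[-4,0]$ if the decomposition is $(1+z)(1+24z+26z^2+9z^3+z^4)$.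
   Context: Graphs are finite and simple (no loops or parallel edges). An independent set of $G$ is a set of pairwise non-adjacent vertices; $i_j$ is the number of independent sets of cardinality $j$ in $G$ (so $i_0=1$, $i_1=|V(G)|$); the independence number $\alpha=\alpha(G)$ is the maximum size of an independent set. The independence polynomial is $I_G(z)=i_0+i_1z+i_2z^2+\cdots+i_\alpha z^\alpha$, and the reduced independence polynomial is $f_G(z)=I_G(z)-1$. If $G$ is the disjoint union of its connected components $H_1,\dots,H_r$, then $I_G(z)=\prod_{j=1}^r I_{H_j}(z)$. The "decomposition" of the independence polynomial of $G$ means this factorization: the listed factors are, up to order, the independence polynomials $I_{H_j}$ of the connected components of $G$. The lexicographic product $G[H]$ has vertex set $V(G)\times V(H)$, with $(u,v)$ adjacent to $(u',v')$ if $u$ is adjacent to $u'$ in $G$, or $u=u'$ and $v$ is adjacent to $v'$ in $H$. $G^m$ denotes the $m$-fold iterated lexicographic product $G[G[\cdots[G]\cdots]]$; one has $f_{G^m}=f_G^{\circ m}$ ($m$-fold composition). The independence attractor of $G$ is $\mathscr{A}(G)=\lim_{m\to\infty}\mathrm{Roots}(I_{G^m})=\lim_{m\to\infty}f_G^{-m}(-1)$, where $\mathrm{Roots}(p)\subset\mathbb{C}$ is the set of complex roots of $p$, $f_G^{-m}(-1)=\{z\in\mathbb{C}: f_G^{\circ m}(z)=-1\}$, and the limit is in the Hausdorff metric on compact subsets of $\mathbb{C}$. Intervals such as $[-1,0]$ are real intervals viewed as subsets of $\mathbb{C}$. *)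

theory Defs
  imports
    "HOL-Analysis.Analysis"
    "HOL-Computational_Algebra.Polynomial"
    "HOL-Library.Multiset"
    "Graph_Theory.Digraph_Component"
begin

text \<open>
  A finite simple graph is modelled by the locale \<^locale>\<open>graph\<close>: a finite, loop-free, symmetric
  digraph without parallel arcs, so an undirected edge is a pair of opposite arcs.
\<close>

definition indep_sets :: "('a, 'b) pre_digraph \<Rightarrow> 'a set set" where
  "indep_sets G = {S. S \<subseteq> verts G \<and> pairwise (\<lambda>u v. \<not> u \<rightarrow>\<^bsub>G\<^esub> v) S}"

definition indep_count :: "('a, 'b) pre_digraph \<Rightarrow> nat \<Rightarrow> nat" where
  "indep_count G j = card {S \<in> indep_sets G. card S = j}"

definition independence_number :: "('a, 'b) pre_digraph \<Rightarrow> nat" where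
  "independence_number G = Max (card ` indep_sets G)"

definition indep_poly :: "('a, 'b) pre_digraph \<Rightarrow> complex poly" where
  "indep_poly G = (\<Sum>j\<le>independence_number G. monom (of_nat (indep_count G j)) j)"

text \<open>
  For a symmetric digraph the strongly connected components \<^const>\<open>pre_digraph.sccs\<close> are the
  connected components of the undirected graph, as induced subgraphs.  The factors form a multiset
  because distinct components may have the same independence polynomial.
\<close>

definition indep_decomposition :: "('a, 'b) pre_digraph \<Rightarrow> complex poly multiset \<Rightarrow> bool" where
  "indep_decomposition G M \<longleftrightarrow>
     indep_poly G = prod_mset M \<and>
     M = image_mset indep_poly (mset_set (pre_digraph.sccs G))"

definition lex_product ::
    "('a, 'b) pre_digraph \<Rightarrow> ('c, 'd) pre_digraph \<Rightarrow> ('a \<times> 'c) pair_pre_digraph" where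
  "lex_product G H =
     \<lparr> pverts = verts G \<times> verts H,
       parcs = {((u, v), (u', v')) | u v u' v'.
         u \<in> verts G \<and> v \<in> verts H \<and> u' \<in> verts G \<and> v' \<in> verts H \<and>
         (u \<rightarrow>\<^bsub>G\<^esub> u' \<or> u = u' \<and> v \<rightarrow>\<^bsub>H\<^esub> v')} \<rparr>"

definition map_verts :: "('a \<Rightarrow> 'c) \<Rightarrow> 'a pair_pre_digraph \<Rightarrow> 'c pair_pre_digraph" where
  "map_verts f G = \<lparr> pverts = f ` pverts G, parcs = map_prod f f ` parcs G \<rparr>"

text \<open>
  The \<open>m\<close>-fold product would live on \<open>m\<close>-tuples, whose type depends on \<open>m\<close>.  We therefore
  rename a vertex \<open>(u, us)\<close> of \<open>G[G\<^sup>m]\<close> to the list \<open>u # us\<close>; the recursion starts with the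
  one-vertex graph, which is neutral for the lexicographic product up to isomorphism.
\<close>

primrec lex_power :: "('a, 'b) pre_digraph \<Rightarrow> nat \<Rightarrow> 'a list pair_pre_digraph" where
  "lex_power G 0 = \<lparr> pverts = {[]}, parcs = {} \<rparr>"
| "lex_power G (Suc m) =
     map_verts (\<lambda>(u, us). u # us) (lex_product G (with_proj (lex_power G m)))"

text \<open>Only meaningful for nonempty bounded sets; it is a metric on the nonempty compact ones.\<close>

definition hausdorff_distance :: "'a::metric_space set \<Rightarrow> 'a set \<Rightarrow> real" where
  "hausdorff_distance A B = max (SUP x\<in>A. infdist x B) (SUP y\<in>B. infdist y A)"

text \<open>
  The attractor is defined as a limit, so it is expressed as a relation that asserts the existence
  of the limit; \<open>A\<close> is determined by \<open>G\<close> (for nonempty \<open>G\<close>), as Hausdorff limits among nonempty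
  compact sets are unique.
\<close>

definition has_independence_attractor :: "('a, 'b) pre_digraph \<Rightarrow> complex set \<Rightarrow> bool" where
  "has_independence_attractor G A \<longleftrightarrow>
     compact A \<and> A \<noteq> {} \<and>
     (\<lambda>m. hausdorff_distance {z. poly (indep_poly (with_proj (lex_power G m))) z = 0} A)
       \<longlonglongrightarrow> 0"

end

theory Submission
  imports Defs
    "HOL-Computational_Algebra.Fundamental_Theorem_Algebra"
    "HOL-Computational_Algebra.Primes"
begin

text \<open>
  Write \<open>f\<close> for the reduced independence polynomial of \<open>G\<close>.  Since \<open>I = 1 + f\<close> turns lexicographic
  products into compositions (\<open>poly_indep_poly_lex_product\<close>), the roots of the independence
  polynomial of the \<open>m\<close>-th power are the \<open>m\<close>-fold preimages of \<open>-1\<close> under \<open>f\<close>.  A Hausdorff limit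
  \<open>A\<close> of such preimages satisfies \<open>f z \<in> A\<close> iff \<open>z \<in> A\<close>
  (\<open>limit_of_preimages_completely_invariant\<close>).

  If \<open>A\<close> is a segment from \<open>a\<close> to \<open>b\<close>, then \<open>f\<close> behaves like a Chebyshev polynomial: wherever \<open>f\<close>
  takes the value \<open>a\<close> or \<open>b\<close> inside the segment it turns back, so its derivative vanishes there.
  Comparing orders of vanishing and degrees gives, for degree \<open>5\<close>,
  \<open>25 (f - a) (f - b) = (z - a) (z - b) f'\<^sup>2\<close> (\<open>chebyshev_equation_of_invariant_segment\<close>).

  Now \<open>f 0 = 0\<close>, and \<open>f' 0 = n\<close> is the number of vertices; so the equation at \<open>0\<close> says
  \<open>25 a b = n\<^sup>2 a b\<close>.  The case \<open>n = 5\<close> would be the edgeless graph, whose polynomial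
  \<open>(1 + z)^5 - 1\<close> does not satisfy the equation.  Hence one endpoint is \<open>0\<close>, and the equation
  determines \<open>f\<close> from the other endpoint.  That the coefficients of \<open>f\<close> are natural numbers forces
  the other endpoint to be \<open>-4/k\<close> for a natural number \<open>k\<close>, with
  \<open>1 + f = 1 + 25 z + 50 k z\<^sup>2 + 35 k\<^sup>2 z\<^sup>3 + 10 k\<^sup>3 z\<^sup>4 + k\<^sup>4 z\<^sup>5\<close>.  There are at most \<open>300\<close> pairs of vertices, and
  not all of them are independent, whence \<open>k \<le> 5\<close> (\<open>indep_poly_if_segment_attractor\<close>).

  Finally, \<open>1 + f\<close> is the product of the independence polynomials of the components, which have
  natural coefficients, constant term \<open>1\<close> and positive degree.  A finite search shows that the only
  possible linear factor of this kind is \<open>1 + z\<close>, and only for \<open>k \<le> 4\<close>, while a quadratic factor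
  occurs only for \<open>k = 4\<close> and is then \<open>1 + 12 z + 16 z\<^sup>2\<close>.  As that polynomial is not \<open>(1 + z)\<^sup>2\<close>,
  there cannot be two linear factors, and since the degrees add up to \<open>5\<close> only the listed
  factorizations remain (\<open>factorizations_of_segment_indep_poly\<close>).
\<close>

section \<open>Polynomials with a completely invariant segment\<close>

lemma complex_poly_dvd_if_order_le:
  fixes p q :: "complex poly"
  assumes "p \<noteq> 0" and "\<And>r. poly p r = 0 \<Longrightarrow> order r p \<le> order r q"
  shows "p dvd q"
proof (cases "q = 0")
  case False
  have "proots p \<subseteq># proots q"
    unfolding subseteq_mset_def
  proof (rule allI)
    fix r show "count (proots p) r \<le> count (proots q) r"
      using assms False by (cases "poly p r = 0") (auto simp: order_root)
  qed
  then obtain M where M: "proots q = proots p + M"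
    by (auto simp: subset_mset.le_iff_add)
  have "q = smult (lead_coeff q) (\<Prod>x\<in>#proots q. [:- x, 1:])"
    by (simp add: complex_poly_decompose_multiset)
  also have "\<dots> = (\<Prod>x\<in>#proots p. [:- x, 1:]) * smult (lead_coeff q) (\<Prod>x\<in>#M. [:- x, 1:])"
    by (simp add: M)
  finally have "(\<Prod>x\<in>#proots p. [:- x, 1:]) dvd q" by (metis dvdI)
  then have "smult (lead_coeff p) (\<Prod>x\<in>#proots p. [:- x, 1:]) dvd q"
    using assms(1) by (intro smult_dvd) auto
  then show ?thesis by (simp add: complex_poly_decompose_multiset)
qed simp

text \<open>
  In the affine coordinate that identifies the segment with the unit interval, \<open>f\<close> restricted to the
  segment is a real function that attains its minimum \<open>0\<close> at an interior point.
\<close>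

lemma critical_point_if_interior_preimage_of_endpoint:
  fixes f :: "complex poly"
  assumes ab: "a \<noteq> b"
    and maps: "\<And>z. z \<in> closed_segment a b \<Longrightarrow> poly f z \<in> closed_segment a b"
    and r: "r \<in> open_segment a b" and fr: "poly f r = a"
  shows "poly (pderiv f) r = 0"
proof -
  define L where "L t = a + complex_of_real t * (b - a)" for t
  define \<phi> where "\<phi> t = (poly f (L t) - a) / (b - a)" for t
  have L: "L t \<in> closed_segment a b" if "0 \<le> t" "t \<le> 1" for t
    using that by (auto simp: in_segment L_def algebra_simps scaleR_conv_of_real intro!: exI[of _ t])
  obtain u where u: "0 < u" "u < 1" "r = L u"
    using r by (auto simp: in_segment L_def algebra_simps scaleR_conv_of_real)
  have \<phi>: "0 \<le> Re (\<phi> t) \<and> Im (\<phi> t) = 0" if t: "0 \<le> t" "t \<le> 1" for t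
  proof -
    obtain s where s: "0 \<le> s" "poly f (L t) = L s"
      using maps[OF L[OF t]] by (auto simp: in_segment L_def algebra_simps scaleR_conv_of_real)
    have "\<phi> t = complex_of_real s" using ab s(2) by (simp add: \<phi>_def L_def)
    then show ?thesis using s by simp
  qed
  have "(\<phi> has_vector_derivative poly (pderiv f) r) (at u)"
  proof -
    have "((\<lambda>z. (poly f (a + z * (b - a)) - a) / (b - a)) has_field_derivative poly (pderiv f) r)
      (at (complex_of_real u))"
      using ab by (auto intro!: derivative_eq_intros poly_DERIV[THEN DERIV_chain2] simp: u L_def)
    then show ?thesis
      unfolding \<phi>_def L_def by (rule has_vector_derivative_real_field)
  qed
  then have "((\<lambda>t. Re (\<phi> t)) has_real_derivative Re (poly (pderiv f) r)) (at u)"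
    and "((\<lambda>t. Im (\<phi> t)) has_real_derivative Im (poly (pderiv f) r)) (at u)"
    by (simp_all add: has_field_derivative_Re has_field_derivative_Im)
  moreover have "\<phi> u = 0" using fr by (simp add: \<phi>_def u(3)[symmetric])
  moreover have "\<forall>y. \<bar>u - y\<bar> < min u (1 - u) \<longrightarrow> Re (\<phi> u) \<le> Re (\<phi> y)"
    using \<phi> \<open>\<phi> u = 0\<close> by (auto simp: abs_real_def split: if_splits)
  moreover have "\<forall>y. \<bar>u - y\<bar> < min u (1 - u) \<longrightarrow> Im (\<phi> u) \<le> Im (\<phi> y)"
    using \<phi> \<open>\<phi> u = 0\<close> by (auto simp: abs_real_def split: if_splits)
  ultimately have "Re (poly (pderiv f) r) = 0" "Im (poly (pderiv f) r) = 0"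
    using u(1,2) DERIV_local_min[where d = "min u (1 - u)"] by fastforce+
  then show ?thesis by (simp add: complex_eq_iff)
qed

text \<open>
  If \<open>f - a\<close> vanishes at \<open>r\<close> to order \<open>e\<close>, then \<open>f'\<^sup>2\<close> vanishes there to order \<open>2 (e - 1)\<close>.  This is at
  least \<open>e\<close> when \<open>r\<close> is an interior point, because then \<open>e \<ge> 2\<close>; at an endpoint the factor
  \<open>(z - a) (z - b)\<close> supplies the missing order when \<open>e = 1\<close>.
\<close>

lemma order_fibre_le:
  fixes f :: "complex poly"
  assumes ab: "a \<noteq> b" and deg: "degree f > 0"
    and inv: "\<And>z. poly f z \<in> closed_segment a b \<longleftrightarrow> z \<in> closed_segment a b"
    and fr: "poly f r = a"
  shows "order r ((f - [:a:]) * (f - [:b:])) \<le> order r ([:-a, 1:] * [:-b, 1:] * (pderiv f)\<^sup>2)"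
proof -
  have nz: "f - [:c:] \<noteq> 0" for c
    using deg by auto
  have nz': "pderiv f \<noteq> 0" using deg by (simp add: pderiv_eq_0_iff)
  have "order r (f - [:b:]) = 0" using ab fr by (intro order_0I) simp
  then have l: "order r ((f - [:a:]) * (f - [:b:])) = order r (f - [:a:])"
    using nz by (simp add: order_mult del: mult_pCons_right mult_pCons_left)
  have e: "order r (f - [:a:]) = Suc (order r (pderiv f))"
    using order_pderiv[of "f - [:a:]" r] nz fr by (simp add: pderiv_diff)
  have rhs: "order r ([:-a, 1:] * [:-b, 1:] * (pderiv f)\<^sup>2)
      = order r [:-a, 1:] + order r [:-b, 1:] + 2 * order r (pderiv f)"
    using nz' by (simp add: order_mult power2_eq_square del: mult_pCons_right mult_pCons_left)
  have "r \<in> closed_segment a b" using inv[of r] fr by simp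
  then consider "r = a" | "r = b" | "r \<in> open_segment a b"
    by (auto simp: open_segment_def)
  then have "order r [:-a, 1:] + order r [:-b, 1:] + order r (pderiv f) \<ge> 1"
  proof cases
    case 3
    then have "poly (pderiv f) r = 0"
      using critical_point_if_interior_preimage_of_endpoint[OF ab _ _ fr] inv by blast
    then have "order r (pderiv f) > 0" using nz' by (simp add: order_gt_0_iff)
    then show ?thesis by simp
  qed (use order_power_n_n[of a 1] order_power_n_n[of b 1] in auto)
  then show ?thesis unfolding l e rhs by simp
qed

text \<open>
  The differential equation of the Chebyshev polynomials, transported to the segment.  By the previous
  lemma, which applies to both endpoints by symmetry, the left-hand side divides the right-hand side;
  the degrees agree, so the two differ by a constant factor, which the leading coefficients determine.
\<close>

theorem chebyshev_equation_of_invariant_segment: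
  fixes f :: "complex poly"
  assumes ab: "a \<noteq> b" and deg: "degree f > 0"
    and inv: "\<And>z. poly f z \<in> closed_segment a b \<longleftrightarrow> z \<in> closed_segment a b"
  shows "smult ((of_nat (degree f))\<^sup>2) ((f - [:a:]) * (f - [:b:]))
    = [:-a, 1:] * [:-b, 1:] * (pderiv f)\<^sup>2"
proof -
  define P where "P = (f - [:a:]) * (f - [:b:])"
  define Q where "Q = [:-a, 1:] * [:-b, 1:] * (pderiv f)\<^sup>2"
  have nz: "f - [:c:] \<noteq> 0" for c
    using deg by auto
  have P0: "P \<noteq> 0" using nz by (simp add: P_def del: mult_pCons_right mult_pCons_left)
  have nz': "pderiv f \<noteq> 0" using deg by (simp add: pderiv_eq_0_iff)
  have "P dvd Q"
  proof (rule complex_poly_dvd_if_order_le[OF P0])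
    fix r assume "poly P r = 0"
    then consider "poly f r = a" | "poly f r = b" by (auto simp: P_def)
    then show "order r P \<le> order r Q"
    proof cases
      case 1
      then show ?thesis unfolding P_def Q_def by (intro order_fibre_le assms)
    next
      case 2
      have "order r ((f - [:b:]) * (f - [:a:])) \<le> order r ([:-b, 1:] * [:-a, 1:] * (pderiv f)\<^sup>2)"
        using assms 2 by (intro order_fibre_le) (auto simp: closed_segment_commute)
      then show ?thesis unfolding P_def Q_def by (simp only: mult.commute mult.left_commute)
    qed
  qed
  then obtain c where c: "Q = P * c" by blast
  have degc: "degree (f - [:d:]) = degree f" for d
    using degree_add_eq_left[of "[:- d:]" f] deg by (simp add: diff_conv_add_uminus del: add_uminus_conv_diff)
  have dP: "degree P = 2 * degree f"
    using nz by (simp add: P_def degree_mult_eq degc del: mult_pCons_right mult_pCons_left)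
  have dQ: "degree Q = 2 * degree f"
    using nz' deg by (simp add: Q_def degree_mult_eq degree_power_eq degree_pderiv
        del: mult_pCons_right mult_pCons_left)
  have Q0: "Q \<noteq> 0" using dQ deg by auto
  then have "c \<noteq> 0" using c by auto
  then have "degree c = 0" using c dP dQ P0 by (simp add: degree_mult_eq)
  then obtain k where k: "c = [:k:]" using degree_eq_zeroE by blast
  have lf: "lead_coeff (f - [:d:]) = lead_coeff f" for d
    using degc[of d] deg by (simp add: coeff_pCons split: nat.splits)
  have "lead_coeff Q = (of_nat (degree f) * lead_coeff f)\<^sup>2"
    unfolding Q_def lead_coeff_mult lead_coeff_power
    using deg by (simp add: degree_pderiv coeff_pderiv)
  moreover have "lead_coeff P = (lead_coeff f)\<^sup>2"
    unfolding P_def lead_coeff_mult lf by (simp add: power2_eq_square)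
  moreover have "lead_coeff Q = k * lead_coeff P"
    using c k by (simp only: lead_coeff_mult) simp
  ultimately have "k = (of_nat (degree f))\<^sup>2"
    using deg by (auto simp: power_mult_distrib)
  then show ?thesis using c k unfolding P_def Q_def by simp
qed

section \<open>Hausdorff limits of iterated preimages\<close>

text \<open>
  A quantitative form of the continuity of roots: the modulus of \<open>f z - w\<close> is that of the leading coefficient times the
  product of the distances from \<open>z\<close> to the roots of \<open>f - w\<close>, so the nearest of these roots will do.
\<close>

lemma near_preimage:
  fixes f :: "complex poly"
  assumes "degree f > 0"
  obtains \<rho> where "poly f \<rho> = w" "norm (z - \<rho>) ^ degree f * norm (lead_coeff f) \<le> norm (poly f z - w)"
proof -
  define p where "p = f - [:w:]"
  have dp: "degree p = degree f"
    using degree_add_eq_left[of "[:- w:]" f] assms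
    by (simp add: p_def diff_conv_add_uminus del: add_uminus_conv_diff)
  have lp: "lead_coeff p = lead_coeff f"
    using dp assms by (simp add: p_def coeff_pCons split: nat.splits)
  have p0: "p \<noteq> 0" using dp assms by auto
  have ne: "proots p \<noteq> {#}" using size_proots_complex[of p] dp assms by auto
  obtain \<rho> where \<rho>: "\<rho> \<in># proots p" "\<And>x. x \<in># proots p \<Longrightarrow> norm (z - \<rho>) \<le> norm (z - x)"
    using ex_is_arg_min_if_finite[of "set_mset (proots p)" "\<lambda>x. norm (z - x)"] ne
    by (auto simp: is_arg_min_linorder)
  have *: "norm (z - \<rho>) ^ size M \<le> norm (\<Prod>x\<in>#M. z - x)"
    if "\<And>x. x \<in># M \<Longrightarrow> norm (z - \<rho>) \<le> norm (z - x)" for M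
    using that by (induction M) (auto simp: norm_mult intro!: mult_mono)
  have "poly p z = lead_coeff p * (\<Prod>x\<in>#proots p. z - x)"
    by (subst complex_poly_decompose_multiset[symmetric])
      (simp add: poly_prod_mset image_mset.compositionality o_def)
  then have "norm (poly f z - w) = norm (lead_coeff f) * norm (\<Prod>x\<in>#proots p. z - x)"
    unfolding lp by (simp add: p_def norm_mult)
  moreover have "norm (z - \<rho>) ^ degree f \<le> norm (\<Prod>x\<in>#proots p. z - x)"
    using *[of "proots p"] \<rho>(2) by (simp add: size_proots_complex dp)
  ultimately have "norm (z - \<rho>) ^ degree f * norm (lead_coeff f) \<le> norm (poly f z - w)"
    by (simp add: mult.commute mult_left_mono)
  moreover have "poly f \<rho> = w" using \<rho>(1) p0 by (simp add: p_def)
  ultimately show ?thesis using that by blast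
qed

lemma infdist_le_hausdorff_distance:
  assumes "compact A" "compact B" "A \<noteq> {}" "B \<noteq> {}"
  shows "x \<in> A \<Longrightarrow> infdist x B \<le> hausdorff_distance A B"
    and "y \<in> B \<Longrightarrow> infdist y A \<le> hausdorff_distance A B"
proof -
  have bdd: "bdd_above ((\<lambda>x. infdist x D) ` C)" if "compact C" for C D :: "'a set"
    using that
    by (intro bounded_imp_bdd_above compact_imp_bounded compact_continuous_image continuous_intros)
  show "infdist x B \<le> hausdorff_distance A B" if "x \<in> A"
    unfolding hausdorff_distance_def
    using cSUP_upper[OF that bdd[OF assms(1)]] by (simp add: le_max_iff_disj)
  show "infdist y A \<le> hausdorff_distance A B" if "y \<in> B"
    unfolding hausdorff_distance_def
    using cSUP_upper[OF that bdd[OF assms(2)]] by (simp add: le_max_iff_disj)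
qed

lemma mem_compact_if_limit_of_near_points:
  assumes "compact A" "A \<noteq> {}" and "h \<longlonglongrightarrow> 0" "z \<longlonglongrightarrow> l" "\<And>m. infdist (z m) A \<le> h m"
  shows "l \<in> A"
proof -
  have "(\<lambda>m. infdist (z m) A) \<longlonglongrightarrow> infdist l A"
    using assms(4) by (intro tendsto_intros)
  moreover have "(\<lambda>m. infdist (z m) A) \<longlonglongrightarrow> 0"
    by (rule real_tendsto_sandwich[OF _ _ tendsto_const assms(3)]) (auto simp: assms(5) infdist_nonneg)
  ultimately have "infdist l A = 0" by (rule LIMSEQ_unique)
  then show ?thesis
    using assms(1,2) by (simp add: in_closed_iff_infdist_zero compact_imp_closed)
qed

text \<open>
  A point of \<open>A\<close> is a limit of points of the sets \<open>S m\<close>, and \<open>f\<close> moves these to points of the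
  preceding sets, which are close to \<open>A\<close> as well.  Conversely, points of \<open>S m\<close> that converge to
  \<open>f z\<close> have preimages that converge to \<open>z\<close>, by the continuity of roots.
\<close>

theorem limit_of_preimages_completely_invariant:
  fixes f :: "complex poly" and S :: "nat \<Rightarrow> complex set"
  assumes deg: "degree f > 0"
    and S: "\<And>m. S (Suc m) = {z. poly f z \<in> S m}" "\<And>m. compact (S m)" "\<And>m. S m \<noteq> {}"
    and A: "compact A" "A \<noteq> {}" and lim: "(\<lambda>m. hausdorff_distance (S m) A) \<longlonglongrightarrow> 0"
  shows "poly f z \<in> A \<longleftrightarrow> z \<in> A"
proof
  define h where "h m = hausdorff_distance (S m) A" for m
  have h: "h \<longlonglongrightarrow> 0" and h': "(\<lambda>m. h (Suc m)) \<longlonglongrightarrow> 0"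
    using lim filterlim_sequentially_Suc[of h] unfolding h_def by auto
  have near_A: "infdist x A \<le> h m" if "x \<in> S m" for x m
    unfolding h_def using that A S by (intro infdist_le_hausdorff_distance)
  have near_S: "\<exists>s\<in>S m. dist a s \<le> h m" if "a \<in> A" for a m
  proof -
    obtain s where "s \<in> S m" "infdist a (S m) = dist a s"
      using infdist_attains_inf[of "S m" a] S compact_imp_closed by metis
    then show ?thesis
      using infdist_le_hausdorff_distance(2)[OF S(2) A(1) S(3) A(2) that, of m] unfolding h_def by force
  qed
  show "poly f z \<in> A" if zA: "z \<in> A"
  proof -
    obtain s where s: "\<And>m. s m \<in> S m" "\<And>m. dist z (s m) \<le> h m"
      using near_S[OF zA] by metis
    have "(\<lambda>m. dist (s m) z) \<longlonglongrightarrow> 0"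
      by (rule real_tendsto_sandwich[OF _ _ tendsto_const h]) (use s(2) in \<open>auto simp: dist_commute\<close>)
    then have "s \<longlonglongrightarrow> z" using tendsto_dist_iff by blast
    then have "(\<lambda>m. poly f (s (Suc m))) \<longlonglongrightarrow> poly f z"
      by (intro tendsto_intros) (simp add: filterlim_sequentially_Suc)
    then show ?thesis
      using s(1) S(1) by (intro mem_compact_if_limit_of_near_points[OF A h] near_A) auto
  qed
  show "z \<in> A" if fzA: "poly f z \<in> A"
  proof -
    obtain w where w: "\<And>m. w m \<in> S m" "\<And>m. dist (poly f z) (w m) \<le> h m"
      using near_S[OF fzA] by metis
    have "\<exists>\<rho>. poly f \<rho> = w m \<and>
        norm (z - \<rho>) ^ degree f * norm (lead_coeff f) \<le> norm (poly f z - w m)" for m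
      using near_preimage[OF deg] by metis
    then obtain \<rho> where \<rho>: "\<And>m. poly f (\<rho> m) = w m"
        "\<And>m. norm (z - \<rho> m) ^ degree f * norm (lead_coeff f) \<le> norm (poly f z - w m)"
      by metis
    have lc: "norm (lead_coeff f) > 0" using deg by auto
    have quot: "(\<lambda>m. h m / norm (lead_coeff f)) \<longlonglongrightarrow> 0"
      using tendsto_divide[OF h tendsto_const, of "norm (lead_coeff f)"] lc by simp
    have "(\<lambda>m. norm (z - \<rho> m) ^ degree f) \<longlonglongrightarrow> 0"
    proof (rule real_tendsto_sandwich[OF _ _ tendsto_const quot])
      have "norm (z - \<rho> m) ^ degree f * norm (lead_coeff f) \<le> h m" for m
        using \<rho>(2)[of m] w(2)[of m] by (simp add: dist_norm)
      then show "\<forall>\<^sub>F m in sequentially. norm (z - \<rho> m) ^ degree f \<le> h m / norm (lead_coeff f)"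
        using lc by (simp add: pos_le_divide_eq)
    qed auto
    then have "(\<lambda>m. norm (z - \<rho> m)) \<longlonglongrightarrow> 0"
      using deg by (simp add: power_tendsto_0_iff)
    then have "(\<lambda>m. dist (\<rho> m) z) \<longlonglongrightarrow> 0" by (simp add: dist_norm norm_minus_commute)
    then have "\<rho> \<longlonglongrightarrow> z" using tendsto_dist_iff by blast
    then show ?thesis
      using \<rho>(1) w(1) S(1) by (intro mem_compact_if_limit_of_near_points[OF A h'] near_A) auto
  qed
qed

section \<open>Independence polynomials\<close>

lemma finite_indep_sets: "finite (verts G) \<Longrightarrow> finite (indep_sets G)"
  by (rule finite_subset[of _ "Pow (verts G)"]) (auto simp: indep_sets_def)

lemma card_le_independence_number:
  "finite (verts G) \<Longrightarrow> S \<in> indep_sets G \<Longrightarrow> card S \<le> independence_number G"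
  unfolding independence_number_def by (intro Max_ge finite_imageI finite_indep_sets imageI)

lemma empty_in_indep_sets: "{} \<in> indep_sets G"
  by (simp add: indep_sets_def)

lemma coeff_indep_poly:
  assumes "finite (verts G)"
  shows "coeff (indep_poly G) j = of_nat (indep_count G j)"
proof (cases "j \<le> independence_number G")
  case False
  then have "{S \<in> indep_sets G. card S = j} = {}"
    using card_le_independence_number[OF assms] by blast
  then have "indep_count G j = 0" by (simp only: indep_count_def card.empty)
  then show ?thesis using False by (simp add: indep_poly_def coeff_sum)
qed (simp add: indep_poly_def coeff_sum)

lemma indep_count_0 [simp]: "finite (verts G) \<Longrightarrow> indep_count G 0 = 1"
proof -
  assume "finite (verts G)"
  then have "{S \<in> indep_sets G. card S = 0} = {{}}"
    using finite_subset[of _ "verts G"] by (auto simp: indep_sets_def)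
  then show ?thesis by (simp add: indep_count_def)
qed

lemma indep_count_1: "indep_count G 1 = card (verts G)"
proof -
  have "{S \<in> indep_sets G. card S = 1} = (\<lambda>v. {v}) ` verts G"
    by (auto simp: indep_sets_def card_1_singleton_iff)
  then show ?thesis by (simp add: indep_count_def card_image)
qed

lemma indep_count_le_binomial:
  assumes "finite (verts G)"
  shows "indep_count G j \<le> card (verts G) choose j"
  unfolding indep_count_def n_subsets[OF assms, symmetric]
  using assms by (intro card_mono) (auto simp: indep_sets_def)

lemma ex_maximum_indep_set:
  assumes "finite (verts G)"
  obtains S where "S \<in> indep_sets G" "card S = independence_number G"
  using Max_in[of "card ` indep_sets G"] finite_indep_sets[OF assms] empty_in_indep_sets[of G]
  unfolding independence_number_def by fastforce

lemma indep_count_pos: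
  assumes "finite (verts G)" "j \<le> independence_number G"
  shows "indep_count G j > 0"
proof -
  obtain S where S: "S \<in> indep_sets G" "card S = independence_number G"
    using ex_maximum_indep_set[OF assms(1)] .
  obtain T where "T \<subseteq> S" "card T = j" using assms(2) S(2) obtain_subset_with_card_n by metis
  then have "T \<in> {S \<in> indep_sets G. card S = j}"
    using S(1) by (auto simp: indep_sets_def intro: pairwise_subset)
  then show ?thesis
    unfolding indep_count_def using finite_indep_sets[OF assms(1)] by (auto simp: card_gt_0_iff)
qed

lemma degree_indep_poly:
  assumes "finite (verts G)"
  shows "degree (indep_poly G) = independence_number G"
proof (rule antisym)
  show "degree (indep_poly G) \<le> independence_number G"
    unfolding indep_poly_def by (intro degree_sum_le) (auto intro: degree_monom_le order_trans)
  show "independence_number G \<le> degree (indep_poly G)"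
    using indep_count_pos[OF assms order_refl] by (intro le_degree) (simp add: coeff_indep_poly assms)
qed

lemma poly_indep_poly:
  assumes "finite (verts G)"
  shows "poly (indep_poly G) z = (\<Sum>S\<in>indep_sets G. z ^ card S)"
proof -
  have "poly (indep_poly G) z =
      (\<Sum>j\<le>independence_number G. of_nat (card {S \<in> indep_sets G. card S = j}) * z ^ j)"
    by (simp add: indep_poly_def poly_sum poly_monom indep_count_def)
  also have "\<dots> = (\<Sum>j\<le>independence_number G. \<Sum>S\<in>{S \<in> indep_sets G. card S = j}. z ^ card S)"
    by (intro sum.cong) auto
  also have "\<dots> = (\<Sum>S\<in>indep_sets G. z ^ card S)"
    using finite_indep_sets[OF assms] card_le_independence_number[OF assms] by (intro sum.group) auto
  finally show ?thesis .
qed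

lemma independence_number_pos:
  assumes "finite (verts G)" "verts G \<noteq> {}"
  shows "independence_number G > 0"
proof -
  obtain v where "v \<in> verts G" using assms by blast
  then have "{v} \<in> indep_sets G" by (simp add: indep_sets_def)
  then show ?thesis using card_le_independence_number[OF assms(1)] by fastforce
qed

text \<open>
  Equality would make every pair of distinct vertices non-adjacent, hence the whole vertex set independent.
\<close>

lemma indep_count_2_less:
  assumes fin: "finite (verts G)" and lt: "independence_number G < card (verts G)"
  shows "indep_count G 2 < card (verts G) choose 2"
proof (rule ccontr)
  assume "\<not> ?thesis"
  then have eq: "indep_count G 2 = card {S. S \<subseteq> verts G \<and> card S = 2}"
    using indep_count_le_binomial[OF fin, of 2] by (simp add: n_subsets[OF fin])
  have "{S \<in> indep_sets G. card S = 2} = {S. S \<subseteq> verts G \<and> card S = 2}"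
    using fin eq by (intro card_subset_eq) (auto simp: indep_sets_def indep_count_def)
  then have "{u, v} \<in> indep_sets G" if "u \<in> verts G" "v \<in> verts G" "u \<noteq> v" for u v
    using that by (auto simp: set_eq_iff)
  then have "verts G \<in> indep_sets G"
    unfolding indep_sets_def by (simp add: pairwise_def)
  then show False using card_le_independence_number[OF fin] lt by fastforce
qed

lemma indep_count_edgeless:
  assumes fin: "finite (verts G)" and eq: "independence_number G = card (verts G)"
  shows "indep_count G j = card (verts G) choose j"
proof -
  obtain S where S: "S \<in> indep_sets G" "card S = card (verts G)"
    using ex_maximum_indep_set[OF fin] eq by metis
  then have "S = verts G"
    using fin by (intro card_subset_eq) (auto simp: indep_sets_def)
  then have "T \<in> indep_sets G" if "T \<subseteq> verts G" for T
    using S(1) that by (auto simp: indep_sets_def intro: pairwise_subset)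
  then have "{S \<in> indep_sets G. card S = j} = {S. S \<subseteq> verts G \<and> card S = j}"
    by (auto simp: indep_sets_def)
  then show ?thesis by (simp add: indep_count_def n_subsets[OF fin])
qed

lemma indep_poly_eq_Poly:
  assumes "finite (verts G)"
  shows "indep_poly G = Poly (map (\<lambda>j. of_nat (indep_count G j)) [0..<Suc (independence_number G)])"
proof (rule poly_eqI)
  fix j
  show "coeff (indep_poly G) j =
      coeff (Poly (map (\<lambda>j. of_nat (indep_count G j)) [0..<Suc (independence_number G)])) j"
  proof (cases "j \<le> independence_number G")
    case True
    then show ?thesis
      by (simp add: coeff_indep_poly[OF assms] nth_default_def nth_append del: upt_Suc)
  next
    case False
    then have "coeff (indep_poly G) j = 0"
      using degree_indep_poly[OF assms] by (simp add: coeff_eq_0)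
    then show ?thesis using False by (simp add: nth_default_def del: upt_Suc)
  qed
qed

section \<open>Disjoint unions\<close>

text \<open>
  The common combinatorial core of the two product formulas below: choosing one member from each family
  \<open>F i\<close> is the same as choosing their union, because the ground sets \<open>V i\<close> are disjoint, and cardinalities
  add up.
\<close>

lemma prod_sum_power_card_disjoint:
  fixes z :: "'c::comm_semiring_1"
  assumes I: "finite I" and V: "\<And>i. i \<in> I \<Longrightarrow> finite (V i)"
    and disj: "\<And>i j. i \<in> I \<Longrightarrow> j \<in> I \<Longrightarrow> i \<noteq> j \<Longrightarrow> V i \<inter> V j = {}"
    and F: "\<And>i U. i \<in> I \<Longrightarrow> U \<in> F i \<Longrightarrow> U \<subseteq> V i"
  shows "(\<Prod>i\<in>I. \<Sum>U\<in>F i. z ^ card U) =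
    (\<Sum>S | S \<subseteq> (\<Union>i\<in>I. V i) \<and> (\<forall>i\<in>I. S \<inter> V i \<in> F i). z ^ card S)"
proof -
  have FV: "F i \<subseteq> Pow (V i)" if "i \<in> I" for i
    using F that by blast
  have "(\<Prod>i\<in>I. \<Sum>U\<in>F i. z ^ card U) = (\<Sum>g\<in>PiE I F. \<Prod>i\<in>I. z ^ card (g i))"
    using I V FV by (intro prod_sum_PiE) (auto intro: finite_subset)
  also have "\<dots> = (\<Sum>S | S \<subseteq> (\<Union>i\<in>I. V i) \<and> (\<forall>i\<in>I. S \<inter> V i \<in> F i). z ^ card S)"
  proof (rule sum.reindex_bij_witness[where i = "\<lambda>S. \<lambda>i\<in>I. S \<inter> V i" and j = "\<lambda>g. \<Union>i\<in>I. g i"])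
    have glue: "(\<Union>i\<in>I. g i) \<inter> V j = g j" if "g \<in> PiE I F" "j \<in> I" for g j
    proof -
      have "g i \<subseteq> V i" if "i \<in> I" for i using F that \<open>g \<in> PiE I F\<close> by (auto simp: PiE_iff)
      then show ?thesis using disj[of _ j] \<open>j \<in> I\<close> by blast
    qed
    fix g assume g: "g \<in> PiE I F"
    show "(\<lambda>i\<in>I. (\<Union>i\<in>I. g i) \<inter> V i) = g"
      using glue[OF g] g by (auto simp: PiE_iff extensional_def fun_eq_iff)
    have sub: "g i \<subseteq> V i" if "i \<in> I" for i using F that g by (auto simp: PiE_iff)
    then show "(\<Union>i\<in>I. g i) \<in> {S. S \<subseteq> (\<Union>i\<in>I. V i) \<and> (\<forall>i\<in>I. S \<inter> V i \<in> F i)}"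
      using glue[OF g] g by (auto simp: PiE_iff)
    have "card (\<Union>i\<in>I. g i) = (\<Sum>i\<in>I. card (g i))"
      using I V sub disj by (intro card_UN_disjoint) (auto intro: finite_subset, blast)
    then show "z ^ card (\<Union>i\<in>I. g i) = (\<Prod>i\<in>I. z ^ card (g i))"
      by (simp add: power_sum)
  qed auto
  finally show ?thesis .
qed

lemma dominates_induced_subgraph_iff:
  assumes "induced_subgraph H G" "u \<in> verts H" "v \<in> verts H"
  shows "u \<rightarrow>\<^bsub>H\<^esub> v \<longleftrightarrow> u \<rightarrow>\<^bsub>G\<^esub> v"
  using assms by (auto simp: induced_subgraph_def subgraph_def compatible_def arcs_ends_def
      arc_to_ends_def image_iff)

context graph begin

lemma verts_sccs_Union: "(\<Union>H\<in>sccs. verts H) = verts G"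
proof -
  have "(\<Union>H\<in>sccs. verts H) = \<Union> sccs_verts" by (simp add: sccs_verts_conv)
  also have "\<dots> = verts G"
    using scc_of_in_sccs_verts in_scc_of_self sccs_verts_subsets by blast
  finally show ?thesis .
qed

lemma finite_sccs: "finite sccs"
  by (simp add: sccs_conv_sccs_verts finite_sccs_verts)

lemma finite_verts_scc: "H \<in> sccs \<Longrightarrow> finite (verts H)"
  using verts_sccs_Union finite_subset[OF _ finite_verts] by blast

lemma sccs_disjoint: "H \<in> sccs \<Longrightarrow> K \<in> sccs \<Longrightarrow> H \<noteq> K \<Longrightarrow> verts H \<inter> verts K = {}"
  using sccs_verts_disjoint[of "verts H" "verts K"] inj_on_verts_sccs
  by (simp add: sccs_verts_conv inj_on_def) blast

lemma dominates_same_scc: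
  assumes "u \<rightarrow> v" "H \<in> sccs" "u \<in> verts H"
  shows "v \<in> verts H"
proof -
  have "verts H \<in> sccs_verts" using assms(2) by (simp add: sccs_verts_conv)
  moreover have "u \<rightarrow>\<^sup>* v" using assms(1) by auto
  moreover from this have "v \<rightarrow>\<^sup>* u" by (rule symmetric_reachable')
  ultimately show ?thesis using assms(3) unfolding in_sccs_verts_conv_reachable by blast
qed

text \<open>
  Adjacent vertices lie in the same component, so independence can be tested within the components.
\<close>

lemma indep_sets_by_components:
  "indep_sets G = {S. S \<subseteq> (\<Union>H\<in>sccs. verts H) \<and> (\<forall>H\<in>sccs. S \<inter> verts H \<in> indep_sets H)}"
    (is "?L = ?R")
proof (intro equalityI subsetI)
  have adj: "u \<rightarrow>\<^bsub>H\<^esub> v \<longleftrightarrow> u \<rightarrow> v" if "H \<in> sccs" "u \<in> verts H" "v \<in> verts H" for H u v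
    using that by (intro dominates_induced_subgraph_iff) (auto simp: sccs_def)
  show "S \<in> ?R" if "S \<in> ?L" for S
    using that by (auto simp: indep_sets_def pairwise_def verts_sccs_Union adj)
  show "S \<in> ?L" if S: "S \<in> ?R" for S
    unfolding indep_sets_def
  proof (intro CollectI conjI pairwiseI)
    show "S \<subseteq> verts G" using S verts_sccs_Union by simp
    fix u v assume uv: "u \<in> S" "v \<in> S" "u \<noteq> v"
    then obtain H where H: "H \<in> sccs" "u \<in> verts H" using S by blast
    show "\<not> u \<rightarrow> v"
    proof
      assume "u \<rightarrow> v"
      then have "v \<in> verts H" using H by (rule dominates_same_scc)
      then have "u \<rightarrow>\<^bsub>H\<^esub> v" using adj[OF H] \<open>u \<rightarrow> v\<close> by blast
      moreover have "S \<inter> verts H \<in> indep_sets H" using S H(1) by blast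
      ultimately show False
        using H uv \<open>v \<in> verts H\<close> unfolding indep_sets_def pairwise_def by blast
    qed
  qed
qed

theorem indep_poly_eq_prod_components: "indep_poly G = (\<Prod>H\<in>sccs. indep_poly H)"
proof -
  have "poly (indep_poly G) z = poly (\<Prod>H\<in>sccs. indep_poly H) z" for z
  proof -
    have "poly (\<Prod>H\<in>sccs. indep_poly H) z = (\<Prod>H\<in>sccs. \<Sum>U\<in>indep_sets H. z ^ card U)"
      by (simp add: poly_prod poly_indep_poly finite_verts_scc)
    also have "\<dots> = (\<Sum>S\<in>indep_sets G. z ^ card S)"
      unfolding indep_sets_by_components
      by (intro prod_sum_power_card_disjoint finite_sccs finite_verts_scc sccs_disjoint)
        (auto simp: indep_sets_def)
    finally show ?thesis by (simp add: poly_indep_poly)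
  qed
  then show ?thesis by (simp add: poly_eq_poly_eq_iff fun_eq_iff flip: poly_eq_poly_eq_iff)
qed

lemma indep_decomposition_components:
  "indep_decomposition G (image_mset indep_poly (mset_set sccs))"
  by (simp add: indep_decomposition_def indep_poly_eq_prod_components prod_unfold_prod_mset)

end

section \<open>Lexicographic products and powers\<close>

lemma dominates_lex_product:
  "(u, v) \<rightarrow>\<^bsub>with_proj (lex_product G H)\<^esub> (u', v') \<longleftrightarrow>
    u \<in> verts G \<and> v \<in> verts H \<and> u' \<in> verts G \<and> v' \<in> verts H \<and>
    (u \<rightarrow>\<^bsub>G\<^esub> u' \<or> u = u' \<and> v \<rightarrow>\<^bsub>H\<^esub> v')"
  by (simp add: lex_product_def)

text \<open>
  Two distinct vertices of the product with the same first component are adjacent only through \<open>H\<close>, as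
  \<open>G\<close> has no loops; with different first components only through \<open>G\<close>.  So independence separates into a
  condition on the projection and one on each fibre.
\<close>

lemma indep_sets_lex_product_iff:
  assumes loopfree: "\<And>u. \<not> u \<rightarrow>\<^bsub>G\<^esub> u"
  shows "S \<in> indep_sets (with_proj (lex_product G H)) \<longleftrightarrow>
    S \<subseteq> verts G \<times> verts H \<and> fst ` S \<in> indep_sets G \<and> (\<forall>u. {v. (u, v) \<in> S} \<in> indep_sets H)"
  (is "?L \<longleftrightarrow> ?R")
proof
  have V: "verts (with_proj (lex_product G H)) = verts G \<times> verts H"
    by (simp add: lex_product_def)
  show ?R if L: ?L
  proof -
    have S: "S \<subseteq> verts G \<times> verts H" using L V by (auto simp only: indep_sets_def)
    have na: "\<not> (u \<rightarrow>\<^bsub>G\<^esub> u' \<or> u = u' \<and> v \<rightarrow>\<^bsub>H\<^esub> v')"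
      if "(u, v) \<in> S" "(u', v') \<in> S" "(u, v) \<noteq> (u', v')" for u v u' v'
    proof -
      have "\<not> (u, v) \<rightarrow>\<^bsub>with_proj (lex_product G H)\<^esub> (u', v')"
        using L that unfolding indep_sets_def by (auto simp only: mem_Collect_eq pairwise_def)
      then show ?thesis using S that(1,2) unfolding dominates_lex_product by auto
    qed
    have "\<not> u \<rightarrow>\<^bsub>G\<^esub> u'" if uu': "u \<in> fst ` S" "u' \<in> fst ` S" "u \<noteq> u'" for u u'
    proof -
      obtain v v' where "(u, v) \<in> S" "(u', v') \<in> S" using uu' by force
      then show ?thesis using na uu'(3) by simp
    qed
    moreover have "fst ` S \<subseteq> verts G" using S by auto
    ultimately have 1: "fst ` S \<in> indep_sets G"
      unfolding indep_sets_def by (simp add: pairwise_def)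
    have 2: "{v. (u, v) \<in> S} \<in> indep_sets H" for u
    proof -
      have "{v. (u, v) \<in> S} \<subseteq> verts H" using S by auto
      moreover have "\<not> v \<rightarrow>\<^bsub>H\<^esub> v'" if "(u, v) \<in> S" "(u, v') \<in> S" "v \<noteq> v'" for v v'
        using na that by simp
      ultimately show ?thesis unfolding indep_sets_def by (simp add: pairwise_def)
    qed
    show ?thesis using S 1 2 by simp
  qed
  show ?L if R: ?R
    unfolding indep_sets_def V
  proof (intro CollectI conjI pairwiseI)
    show "S \<subseteq> verts G \<times> verts H" using R by simp
    fix p q assume pq: "p \<in> S" "q \<in> S" "p \<noteq> q"
    obtain u v u' v' where e: "p = (u, v)" "q = (u', v')" by (cases p, cases q)
    have "\<not> u \<rightarrow>\<^bsub>G\<^esub> u'"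
    proof (cases "u = u'")
      case False
      have "u \<in> fst ` S" "u' \<in> fst ` S" using pq e by force+
      moreover have "pairwise (\<lambda>u v. \<not> u \<rightarrow>\<^bsub>G\<^esub> v) (fst ` S)"
        using R by (simp only: indep_sets_def mem_Collect_eq)
      ultimately show ?thesis using False unfolding pairwise_def by blast
    qed (simp add: loopfree)
    moreover have "\<not> v \<rightarrow>\<^bsub>H\<^esub> v'" if "u = u'"
    proof -
      have "{v. (u, v) \<in> S} \<in> indep_sets H" "v \<noteq> v'" using R that pq e by simp_all
      then show ?thesis using that pq e by (simp add: indep_sets_def pairwise_def)
    qed
    ultimately show "\<not> p \<rightarrow>\<^bsub>with_proj (lex_product G H)\<^esub> q"
      unfolding e dominates_lex_product by blast
  qed
qed

text \<open>
  An independent set of the product consists of an independent set \<open>T\<close> of \<open>G\<close>, namely its projection, and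
  of a nonempty independent set of \<open>H\<close> over each point of \<open>T\<close>.  Each point of \<open>T\<close> thus contributes the
  factor \<open>I_H(z) - 1\<close>.
\<close>

theorem poly_indep_poly_lex_product:
  fixes G :: "('a, 'b) pre_digraph" and H :: "('c, 'd) pre_digraph"
  assumes fin: "finite (verts G)" "finite (verts H)" and loopfree: "\<And>u. \<not> u \<rightarrow>\<^bsub>G\<^esub> u"
  shows "poly (indep_poly (with_proj (lex_product G H))) z
    = poly (indep_poly G) (poly (indep_poly H) z - 1)"
proof -
  let ?GH = "with_proj (lex_product G H)"
  have fin': "finite (verts ?GH)" using fin by (simp add: lex_product_def)
  define F where "F u = (\<lambda>U. {u} \<times> U) ` (indep_sets H - {{}})" for u :: 'a
  have sumF: "poly (indep_poly H) z - 1 = (\<Sum>U\<in>F u. z ^ card U)" for u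
  proof -
    have "(\<Sum>U\<in>F u. z ^ card U) = (\<Sum>U\<in>indep_sets H - {{}}. z ^ card U)"
      unfolding F_def by (subst sum.reindex) (auto simp: inj_on_def card_cartesian_product)
    also have "\<dots> = poly (indep_poly H) z - 1"
      using finite_indep_sets[OF fin(2)] empty_in_indep_sets[of H]
      by (simp add: poly_indep_poly[OF fin(2)] sum_diff1)
    finally show ?thesis by simp
  qed
  \<comment> \<open>The left-hand side is the index set produced by the gluing lemma for the fibres over \<open>T\<close>.\<close>
  have fib: "{S. S \<subseteq> (\<Union>u\<in>T. {u} \<times> verts H) \<and> (\<forall>u\<in>T. S \<inter> {u} \<times> verts H \<in> F u)}
      = {S \<in> indep_sets ?GH. fst ` S = T}" (is "?L = ?R") if T: "T \<in> indep_sets G" for T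
  proof (intro equalityI subsetI)
    have TG: "T \<subseteq> verts G" using T by (simp add: indep_sets_def)
    fix S assume S: "S \<in> ?L"
    have slice: "{v. (u, v) \<in> S} \<in> indep_sets H - {{}}" if u: "u \<in> T" for u
    proof -
      obtain U where U: "U \<in> indep_sets H - {{}}" "S \<inter> {u} \<times> verts H = {u} \<times> U"
        using S u unfolding F_def by blast
      have "{v. (u, v) \<in> S} = U" using S U(2) by auto
      then show ?thesis using U by simp
    qed
    have ST: "fst ` S = T" using S slice by force
    moreover have "{v. (u, v) \<in> S} \<in> indep_sets H" for u
    proof (cases "u \<in> T")
      case False
      then have "{v. (u, v) \<in> S} = {}" using S by auto
      then show ?thesis by (simp add: empty_in_indep_sets)
    qed (use slice in auto)
    moreover have "S \<subseteq> verts G \<times> verts H" using S TG by auto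
    ultimately show "S \<in> ?R" using T by (simp add: indep_sets_lex_product_iff[OF loopfree])
  next
    fix S assume "S \<in> ?R"
    then have S: "S \<subseteq> verts G \<times> verts H" "fst ` S = T" "\<And>u. {v. (u, v) \<in> S} \<in> indep_sets H"
      by (auto simp: indep_sets_lex_product_iff[OF loopfree])
    have "S \<inter> {u} \<times> verts H \<in> F u" if "u \<in> T" for u
      unfolding F_def
    proof (rule image_eqI)
      show "S \<inter> {u} \<times> verts H = {u} \<times> {v. (u, v) \<in> S}" using S(1) by auto
      show "{v. (u, v) \<in> S} \<in> indep_sets H - {{}}" using S(2,3) that by force
    qed
    then show "S \<in> ?L" using S(1,2) by force
  qed
  have "poly (indep_poly G) (poly (indep_poly H) z - 1)
      = (\<Sum>T\<in>indep_sets G. \<Prod>u\<in>T. \<Sum>U\<in>F u. z ^ card U)"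
    by (simp add: poly_indep_poly[OF fin(1)] flip: sumF)
  also have "\<dots> = (\<Sum>T\<in>indep_sets G. \<Sum>S\<in>{S \<in> indep_sets ?GH. fst ` S = T}. z ^ card S)"
  proof (rule sum.cong[OF refl])
    fix T assume T: "T \<in> indep_sets G"
    then have "finite T" using fin(1) finite_subset by (auto simp: indep_sets_def)
    then show "(\<Prod>u\<in>T. \<Sum>U\<in>F u. z ^ card U)
        = (\<Sum>S\<in>{S \<in> indep_sets ?GH. fst ` S = T}. z ^ card S)"
      unfolding fib[OF T, symmetric]
      by (intro prod_sum_power_card_disjoint) (auto simp: fin F_def indep_sets_def)
  qed
  also have "\<dots> = (\<Sum>S\<in>indep_sets ?GH. z ^ card S)"
    using finite_indep_sets[OF fin(1)] finite_indep_sets[OF fin']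
    by (intro sum.group) (auto simp: indep_sets_lex_product_iff[OF loopfree])
  finally show ?thesis by (simp add: poly_indep_poly[OF fin'])
qed

lemma indep_sets_map_verts:
  assumes "inj f"
  shows "indep_sets (with_proj (map_verts f P)) = (`) f ` indep_sets (with_proj P)"
proof -
  have adj: "f x \<rightarrow>\<^bsub>with_proj (map_verts f P)\<^esub> f y \<longleftrightarrow> x \<rightarrow>\<^bsub>with_proj P\<^esub> y" for x y
    using assms by (force simp: map_verts_def image_iff inj_eq)
  have pw: "pairwise (\<lambda>u v. \<not> u \<rightarrow>\<^bsub>with_proj (map_verts f P)\<^esub> v) (f ` U)
      \<longleftrightarrow> pairwise (\<lambda>u v. \<not> u \<rightarrow>\<^bsub>with_proj P\<^esub> v) U" for U
    unfolding pairwise_def using adj assms by (simp add: inj_eq)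
  have V: "verts (with_proj (map_verts f P)) = f ` verts (with_proj P)" by (simp add: map_verts_def)
  show ?thesis
    unfolding indep_sets_def
  proof (intro equalityI subsetI)
    fix T assume T: "T \<in> {S. S \<subseteq> verts (with_proj (map_verts f P))
        \<and> pairwise (\<lambda>u v. \<not> u \<rightarrow>\<^bsub>with_proj (map_verts f P)\<^esub> v) S}"
    then obtain U where "U \<subseteq> verts (with_proj P)" "T = f ` U"
      unfolding V subset_image_iff by blast
    then show "T \<in> (`) f ` {S. S \<subseteq> verts (with_proj P)
        \<and> pairwise (\<lambda>u v. \<not> u \<rightarrow>\<^bsub>with_proj P\<^esub> v) S}"
      using T pw[of U] by (intro image_eqI[of _ _ U]) (simp_all only: mem_Collect_eq)
  qed (use V pw in \<open>force simp only: image_iff mem_Collect_eq\<close>)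
qed

lemma poly_indep_poly_map_verts:
  assumes "inj f" "finite (pverts P)"
  shows "poly (indep_poly (with_proj (map_verts f P))) z = poly (indep_poly (with_proj P)) z"
proof -
  have fin: "finite (verts (with_proj (map_verts f P)))" "finite (verts (with_proj P))"
    using assms by (simp_all add: map_verts_def)
  have card: "card (f ` S) = card S" for S
    by (rule card_image[OF inj_on_subset[OF assms(1) subset_UNIV]])
  have "inj ((`) f)" using assms(1) by (simp add: inj_on_image)
  then show ?thesis
    unfolding poly_indep_poly[OF fin(1)] poly_indep_poly[OF fin(2)] indep_sets_map_verts[OF assms(1)]
    by (subst sum.reindex[OF inj_on_subset[OF _ subset_UNIV]]) (simp_all add: card)
qed

theorem poly_indep_poly_lex_power:
  assumes fin: "finite (verts G)" and loopfree: "\<And>u. \<not> u \<rightarrow>\<^bsub>G\<^esub> u"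
  shows "poly (indep_poly (with_proj (lex_power G m))) z = 1 + (poly (indep_poly G - 1) ^^ m) z"
proof (induction m)
  case 0
  have "indep_sets (with_proj (lex_power G 0)) = {{}, {[]}}"
    by (auto simp: indep_sets_def pairwise_def)
  then show ?case by (simp add: poly_indep_poly del: lex_power.simps) (simp add: poly_indep_poly)
next
  case (Suc m)
  have fm: "finite (pverts (lex_power G n))" for n
    using fin by (induction n) (auto simp: map_verts_def lex_product_def)
  have inj: "inj (\<lambda>(u, us). u # us)" by (auto simp: inj_def)
  have "poly (indep_poly (with_proj (lex_power G (Suc m)))) z
      = poly (indep_poly (with_proj (lex_product G (with_proj (lex_power G m))))) z"
    using fin fm[of m] by (simp add: poly_indep_poly_map_verts[OF inj] lex_product_def)
  also have "\<dots> = poly (indep_poly G) (poly (indep_poly (with_proj (lex_power G m))) z - 1)"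
    using fin fm[of m] loopfree by (intro poly_indep_poly_lex_product) auto
  finally show ?case by (simp add: Suc)
qed

text \<open>
  The root sets in the definition of the attractor are the iterated preimages of \<open>-1\<close> under the reduced
  independence polynomial.
\<close>

theorem independence_attractor_completely_invariant:
  assumes fin: "finite (verts G)" "verts G \<noteq> {}" and loopfree: "\<And>u. \<not> u \<rightarrow>\<^bsub>G\<^esub> u"
    and A: "has_independence_attractor G A"
  shows "poly (indep_poly G - 1) z \<in> A \<longleftrightarrow> z \<in> A"
proof -
  define f where "f = indep_poly G - 1"
  define S where "S m = {z. poly (indep_poly (with_proj (lex_power G m))) z = 0}" for m
  have S: "S m = {z. (poly f ^^ m) z = -1}" for m
    unfolding S_def f_def poly_indep_poly_lex_power[OF fin(1) loopfree]
    by (auto simp: add_eq_0_iff)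
  have "coeff f 1 = of_nat (card (verts G))"
    using indep_count_1[of G] by (simp add: f_def coeff_indep_poly[OF fin(1)])
  then have deg: "degree f > 0"
    using fin by (intro Nat.gr0I) (metis One_nat_def card_gt_0_iff coeff_eq_0 lessI neq0_conv of_nat_eq_0_iff)
  have SSuc: "S (Suc m) = {z. poly f z \<in> S m}" for m
    unfolding S by (simp add: funpow_Suc_right del: funpow.simps)
  have ne: "S m \<noteq> {}" for m
  proof (induction m)
    case 0
    show ?case by (simp add: S)
  next
    case (Suc m)
    then obtain w where "w \<in> S m" by blast
    moreover obtain \<rho> where "poly f \<rho> = w" using near_preimage[OF deg] by metis
    ultimately show ?case unfolding SSuc by blast
  qed
  have "finite (S m)" for m
  proof (induction m)
    case (Suc m)
    have "finite {z. poly (f - [:w:]) z = 0}" for w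
      using deg by (intro poly_roots_finite) auto
    moreover have "S (Suc m) = (\<Union>w\<in>S m. {z. poly (f - [:w:]) z = 0})"
      unfolding SSuc by auto
    ultimately show ?case using Suc by simp
  qed (simp add: S)
  then have "compact (S m)" for m by (rule finite_imp_compact)
  with deg SSuc ne A show ?thesis
    unfolding has_independence_attractor_def f_def[symmetric] S_def[symmetric]
    by (intro limit_of_preimages_completely_invariant[of f S]) auto
qed

section \<open>The independence polynomials with a segment as attractor\<close>

text \<open>
  With \<open>0\<close> as one endpoint, the coefficient of \<open>z\<close> in the Chebyshev equation yields \<open>n = 25\<close>, and for
  \<open>j \<ge> 2\<close> that of \<open>z^j\<close> is linear in the \<open>j\<close>-th coefficient of \<open>f\<close> once the lower ones are known.  So the first five coefficients of the equation
  determine \<open>f\<close>, up to the scaling by \<open>b\<close>.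
\<close>

lemma chebyshev_coefficients:
  fixes n s t u v b :: complex
  defines "f \<equiv> [:0, n, s, t, u, v:]"
  assumes "b \<noteq> 0" "n \<noteq> 0"
    and eq: "smult 25 (f * (f - [:b:])) = [:0, 1:] * [:-b, 1:] * (pderiv f)\<^sup>2"
  shows "n = 25" "s * b = -200" "t * b^2 = 560" "u * b^3 = -640" "v * b^4 = 256"
proof -
  have c: "coeff (smult 25 (f * (f - [:b:]))) j = coeff ([:0, 1:] * [:-b, 1:] * (pderiv f)\<^sup>2) j" for j
    using eq by simp
  have "25 * (n * b) = b * (n * n)" using c[of 1] by (auto simp: f_def pderiv_pCons power2_eq_square)
  then show n: "n = 25" using \<open>b \<noteq> 0\<close> \<open>n \<noteq> 0\<close> by (auto simp: mult.commute)
  have c2: "25 * (n^2 - b * s) = n^2 - 4 * b * n * s"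
    using c[of 2] by (simp add: f_def pderiv_pCons power2_eq_square numeral_2_eq_2 algebra_simps)
  then show s: "s * b = -200" unfolding n by algebra
  have c3: "25 * (2 * n * s - b * t) = 4 * n * s - b * (6 * n * t + 4 * s^2)"
    using c[of 3] by (simp add: f_def pderiv_pCons power2_eq_square numeral_3_eq_3 algebra_simps)
  then show t: "t * b^2 = 560" using s unfolding n by algebra
  have c4: "25 * (2 * n * t + s^2 - b * u) = 6 * n * t + 4 * s^2 - b * (8 * n * u + 12 * s * t)"
    using c[of 4] by (simp add: f_def pderiv_pCons power2_eq_square eval_nat_numeral algebra_simps)
  then show u: "u * b^3 = -640" using s t unfolding n by algebra
  have c5: "25 * (2 * n * u + 2 * s * t - b * v) =
      8 * n * u + 12 * s * t - b * (10 * n * v + 16 * s * u + 9 * t^2)"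
    using c[of 5] by (simp add: f_def pderiv_pCons power2_eq_square eval_nat_numeral algebra_simps)
  then show "v * b^4 = 256" using s t u unfolding n by algebra
qed

text \<open>
  For \<open>f = (1 + z)^5 - 1\<close> the coefficients of \<open>z\<close> and \<open>z\<^sup>2\<close> in the equation force \<open>a + b = -2\<close> and
  \<open>a b = 1\<close>, so that the segment degenerates to a point.
\<close>

lemma no_chebyshev_edgeless:
  fixes a b :: complex
  defines "f \<equiv> [:0, 5, 10, 10, 5, 1:]"
  assumes eq: "smult 25 ((f - [:a:]) * (f - [:b:])) = [:-a, 1:] * [:-b, 1:] * (pderiv f)\<^sup>2"
  shows "a = b"
proof -
  have c: "coeff (smult 25 ((f - [:a:]) * (f - [:b:]))) j = coeff ([:-a, 1:] * [:-b, 1:] * (pderiv f)\<^sup>2) j" for j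
    using eq by simp
  have 1: "a + b = - 2 * (a * b)"
    using c[of 1] by (simp add: f_def pderiv_pCons power2_eq_square) algebra
  have "600 - 50 * (a + b) = 700 * (a * b)"
    using c[of 2] by (simp add: f_def pderiv_pCons power2_eq_square numeral_2_eq_2) (simp add: algebra_simps)
  then have "(a - b)^2 = 0" using 1 by algebra
  then show ?thesis by simp
qed

lemma fifty_dvd:
  fixes s t :: nat
  assumes "500 * t = 7 * s\<^sup>2"
  shows "50 dvd s"
proof -
  (* 143 is the inverse of 7 modulo 500 *)
  have "s\<^sup>2 + 500 * (2 * s\<^sup>2) = 500 * (143 * t)" using assms by simp
  then have s: "500 dvd s\<^sup>2" by (metis dvd_add_left_iff dvd_triv_left)
  then have "2 dvd s\<^sup>2" "5 dvd s\<^sup>2" by (rule dvd_trans[rotated], simp)+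
  then have "2 dvd s" "5 dvd s" using prime_dvd_power[of 2 s 2] prime_dvd_power[of 5 s 2] by auto
  then have "10 dvd s" by presburger
  then obtain y where y: "s = 10 * y" by blast
  then have "5 dvd y\<^sup>2" using s by (simp add: power2_eq_square)
  then have "5 dvd y" using prime_dvd_power[of 5 y 2] by simp
  then show ?thesis using y by auto
qed

text \<open>
  This is \<open>1 + (2/k) (T(1 + k z/2) - 1)\<close> for the Chebyshev polynomial \<open>T\<close> of degree \<open>5\<close>, that is, \<open>1\<close> plus
  the conjugate of \<open>T\<close> by the increasing affine map from the interval from \<open>-4/k\<close> to \<open>0\<close> onto the interval
  from \<open>-1\<close> to \<open>1\<close>.
\<close>

definition segment_indep_poly :: "nat \<Rightarrow> complex poly" where
  "segment_indep_poly k = [:1, 25, of_nat (50 * k), of_nat (35 * k\<^sup>2), of_nat (10 * k ^ 3), of_nat (k ^ 4):]"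

lemma degree_segment_indep_poly: "k > 0 \<Longrightarrow> degree (segment_indep_poly k) = 5"
  by (simp add: segment_indep_poly_def)

lemma segment_indep_poly_inject: "segment_indep_poly k = segment_indep_poly l \<longleftrightarrow> k = l"
  by (auto simp: segment_indep_poly_def)

text \<open>
  The Chebyshev equation fixes the polynomial up to one parameter, and the integrality of the numbers of
  independent sets of size three makes that parameter a natural number.
\<close>

theorem indep_poly_if_segment_attractor:
  fixes G :: "('a, 'b) pre_digraph"
  assumes G: "graph G" and \<alpha>: "independence_number G = 5"
    and att: "has_independence_attractor G A" and seg: "a \<noteq> b" "A = closed_segment a b"
  obtains k where "1 \<le> k" "k \<le> 5" "indep_poly G = segment_indep_poly k"
    "A = complex_of_real ` {-(4 / real k)..0}"
proof -
  interpret graph G by (rule G)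
  define i where "i = indep_count G"
  define n where "n = card (verts G)"
  define f where "f = indep_poly G - 1"
  have loopfree: "\<not> u \<rightarrow>\<^bsub>G\<^esub> u" for u using adj_not_same by blast
  have n5: "n \<ge> 5"
  proof -
    obtain S where "S \<in> indep_sets G" "card S = 5"
      using ex_maximum_indep_set[OF finite_verts] \<alpha> by metis
    then show ?thesis
      using card_mono[OF finite_verts, of S] by (simp add: n_def indep_sets_def)
  qed
  have i1: "i (Suc 0) = n" using indep_count_1[of G] by (simp add: i_def n_def)
  have "[0..<Suc 5] = [0, Suc 0, 2, 3, 4, 5]" by (simp add: upt_rec)
  then have I: "indep_poly G = [:1, of_nat n, of_nat (i 2), of_nat (i 3), of_nat (i 4), of_nat (i 5):]"
    using i1 unfolding indep_poly_eq_Poly[OF finite_verts] \<alpha> by (simp add: i_def)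
  then have f: "f = [:0, of_nat n, of_nat (i 2), of_nat (i 3), of_nat (i 4), of_nat (i 5):]"
    by (simp add: f_def one_pCons)
  have "i 5 > 0" unfolding i_def by (intro indep_count_pos) (simp_all add: \<alpha>)
  then have deg: "degree f = 5" by (simp add: f)
  have ne: "verts G \<noteq> {}" using n5 by (auto simp: n_def)
  have inv: "poly f z \<in> A \<longleftrightarrow> z \<in> A" for z
    unfolding f_def by (rule independence_attractor_completely_invariant[OF finite_verts ne loopfree att])
  have cheb: "smult 25 ((f - [:c:]) * (f - [:d:])) = [:-c, 1:] * [:-d, 1:] * (pderiv f)\<^sup>2"
    if "c \<noteq> d" "A = closed_segment c d" for c d
    using chebyshev_equation_of_invariant_segment[OF that(1), of f] inv that(2) deg by simp
  have "n \<noteq> 5"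
  proof
    assume "n = 5"
    then have "i j = 5 choose j" for j
      using indep_count_edgeless[OF finite_verts, of j] \<alpha> by (simp add: i_def n_def)
    then have "f = [:0, 5, 10, 10, 5, 1:]"
      using \<open>n = 5\<close> unfolding f by (simp add: eval_nat_numeral)
    then show False using no_chebyshev_edgeless cheb[OF seg] seg(1) by blast
  qed
  have "poly (smult 25 ((f - [:a:]) * (f - [:b:]))) 0 = poly ([:-a, 1:] * [:-b, 1:] * (pderiv f)\<^sup>2) 0"
    by (simp only: cheb[OF seg])
  then have "25 * (a * b) = a * b * (of_nat n)\<^sup>2" by (auto simp: f pderiv_pCons)
  moreover have "(of_nat n)\<^sup>2 \<noteq> (25 :: complex)"
  proof
    assume "(of_nat n)\<^sup>2 = (25 :: complex)"
    then have "of_nat (n\<^sup>2) = complex_of_nat (5\<^sup>2)" by simp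
    then have "n\<^sup>2 = 5\<^sup>2" by (simp only: of_nat_eq_iff)
    then show False using \<open>n \<noteq> 5\<close> by (simp only: power2_eq_iff_nonneg zero_le)
  qed
  ultimately have "a = 0 \<or> b = 0" by (metis mult.commute mult_cancel_left mult_eq_0_iff)
  then obtain e where e: "e \<noteq> 0" "A = closed_segment 0 e"
    using seg closed_segment_commute by metis
  have "smult 25 (f * (f - [:e:])) = [:0, 1:] * [:-e, 1:] * (pderiv f)\<^sup>2"
    using cheb[of 0 e] e by simp
  then have coeffs: "of_nat n = (25 :: complex)" "of_nat (i 2) * e = -200" "of_nat (i 3) * e^2 = 560"
    "of_nat (i 4) * e^3 = -640" "of_nat (i 5) * e^4 = 256"
    using chebyshev_coefficients[of e "of_nat n" "of_nat (i 2)" "of_nat (i 3)" "of_nat (i 4)" "of_nat (i 5)"]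
      e(1) n5 unfolding f by auto
  have n: "n = 25" using coeffs(1) by (metis of_nat_eq_iff of_nat_numeral)
  \<comment> \<open>Multiplying by powers of \<open>i 2\<close> eliminates the endpoint \<open>e\<close>, since \<open>e\<close> times \<open>i 2\<close> is \<open>-200\<close>.\<close>
  have scaled: "complex_of_nat t * (-200) ^ j = c * of_nat (i 2) ^ j"
    if "of_nat t * e ^ j = c" for t j c
    using that by (simp add: power_mult_distrib flip: coeffs(2))
  have "complex_of_nat (500 * i 3) = of_nat (7 * (i 2)\<^sup>2)"
    using scaled[OF coeffs(3)] by simp
  then have i3: "500 * i 3 = 7 * (i 2)\<^sup>2" by (simp only: of_nat_eq_iff)
  then obtain k where k: "i 2 = 50 * k" using fifty_dvd by blast
  have "complex_of_nat (i 4) = of_nat (10 * k ^ 3)"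
    using scaled[OF coeffs(4)] by (simp add: k power_mult_distrib)
  then have i4: "i 4 = 10 * k ^ 3" by (simp only: of_nat_eq_iff)
  have "complex_of_nat (i 5) = of_nat (k ^ 4)"
    using scaled[OF coeffs(5)] by (simp add: k power_mult_distrib)
  then have i5: "i 5 = k ^ 4" by (simp only: of_nat_eq_iff)
  have i3': "i 3 = 35 * k\<^sup>2" using i3 by (simp add: k power_mult_distrib)
  have k1: "1 \<le> k" using \<open>i 5 > 0\<close> i5 by (cases k) auto
  have "i 2 < 25 choose 2"
    unfolding i_def n[symmetric] n_def using \<alpha> n by (intro indep_count_2_less) (simp_all add: n_def)
  then have k5: "k \<le> 5" by (simp add: k choose_two)
  have "50 * of_nat k * e = -200" using coeffs(2) by (simp add: k)
  then have "e = complex_of_real (-(4 / real k))" using k1 by (simp add: field_simps)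
  then have "A = closed_segment (complex_of_real (-(4 / real k))) (complex_of_real 0)"
    by (simp add: e(2) closed_segment_commute)
  also have "\<dots> = complex_of_real ` closed_segment (-(4 / real k)) 0"
    by (rule closed_segment_of_real)
  also have "\<dots> = complex_of_real ` {-(4 / real k)..0}" by (simp add: closed_segment_eq_real_ivl)
  finally have A: "A = complex_of_real ` {-(4 / real k)..0}" .
  have "indep_poly G = segment_indep_poly k"
    unfolding I segment_indep_poly_def n k i3' i4 i5 by simp
  with k1 k5 A show ?thesis by (intro that)
qed

section \<open>Factorizations into component polynomials\<close>

text \<open>
  All \<open>(k, p, r)\<close> with \<open>1 \<le> k \<le> 5\<close> and \<open>p r = k^4\<close>, listed so that the searches below become
  evaluations.  They are easy to enumerate because each \<open>k\<close> up to \<open>5\<close> is a prime power.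
\<close>

definition fourth_power_factorizations :: "(nat \<times> nat \<times> nat) set" where
  "fourth_power_factorizations =
    {(1, 1, 1), (2, 1, 16), (2, 2, 8), (2, 4, 4), (2, 8, 2), (2, 16, 1), (3, 1, 81), (3, 3, 27), (3, 9, 9), (3, 27, 3), (3, 81, 1), (4, 1, 256), (4, 2, 128), (4, 4, 64), (4, 8, 32), (4, 16, 16), (4, 32, 8), (4, 64, 4), (4, 128, 2), (4, 256, 1), (5, 1, 625), (5, 5, 125), (5, 25, 25), (5, 125, 5), (5, 625, 1)}"

lemma mem_fourth_power_factorizations:
  fixes k p r :: nat
  assumes k: "1 \<le> k" "k \<le> 5" and pr: "p * r = k ^ 4"
  shows "(k, p, r) \<in> fourth_power_factorizations"
proof -
  have dvd: "p dvd k ^ 4" using pr by (metis dvd_triv_left)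
  from k consider "k = 1" | "k = 2" | "k = 3" | "k = 4" | "k = 5" by linarith
  then show ?thesis
  proof cases
    case 1
    then show ?thesis using pr by (simp add: fourth_power_factorizations_def)
  next
    case 2
    have "k ^ 4 = 2 ^ 4" using 2 by simp
    then obtain i where i: "i \<le> 4" "p = 2 ^ i"
      using dvd divides_primepow_nat[of 2 p 4] by auto
    then have "i = 0 \<or> i = 1 \<or> i = 2 \<or> i = 3 \<or> i = 4" by linarith
    then show ?thesis using i(2) pr 2 by (elim disjE) (simp_all add: fourth_power_factorizations_def)
  next
    case 3
    have "k ^ 4 = 3 ^ 4" using 3 by simp
    then obtain i where i: "i \<le> 4" "p = 3 ^ i"
      using dvd divides_primepow_nat[of 3 p 4] by auto
    then have "i = 0 \<or> i = 1 \<or> i = 2 \<or> i = 3 \<or> i = 4" by linarith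
    then show ?thesis using i(2) pr 3 by (elim disjE) (simp_all add: fourth_power_factorizations_def)
  next
    case 4
    have "k ^ 4 = 2 ^ 8" using 4 by simp
    then obtain i where i: "i \<le> 8" "p = 2 ^ i"
      using dvd divides_primepow_nat[of 2 p 8] by auto
    then have "i = 0 \<or> i = 1 \<or> i = 2 \<or> i = 3 \<or> i = 4 \<or> i = 5 \<or> i = 6 \<or> i = 7 \<or> i = 8" by linarith
    then show ?thesis using i(2) pr 4 by (elim disjE) (simp_all add: fourth_power_factorizations_def)
  next
    case 5
    have "k ^ 4 = 5 ^ 4" using 5 by simp
    then obtain i where i: "i \<le> 4" "p = 5 ^ i"
      using dvd divides_primepow_nat[of 5 p 4] by auto
    then have "i = 0 \<or> i = 1 \<or> i = 2 \<or> i = 3 \<or> i = 4" by linarith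
    then show ?thesis using i(2) pr 5 by (elim disjE) (simp_all add: fourth_power_factorizations_def)
  qed
qed

text \<open>
  The equations compare the coefficients in \<open>(1 + m z) (1 + a z + b z\<^sup>2 + c z\<^sup>3 + d z^4)\<close>
  and in \<open>segment_indep_poly k\<close>.  Since \<open>m\<close> divides \<open>k^4\<close>, few values are left for it, and each of them determines \<open>a, b, c, d\<close>.
\<close>

lemma linear_factor_nat:
  fixes k m a b c d :: nat
  assumes k: "1 \<le> k" "k \<le> 5"
    and e: "m + a = 25" "m * a + b = 50 * k" "m * b + c = 35 * k\<^sup>2" "m * c + d = 10 * k ^ 3" "m * d = k ^ 4"
  shows "m = 1 \<and> k \<le> 4"
proof -
  have "(k, m, d) \<in> fourth_power_factorizations"
    using k e(5) by (rule mem_fourth_power_factorizations)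
  then show ?thesis
    unfolding fourth_power_factorizations_def using e by auto
qed

text \<open>
  The equations compare the coefficients in \<open>(1 + m z + p z\<^sup>2) (1 + s z + q z\<^sup>2 + r z\<^sup>3)\<close> and in
  \<open>segment_indep_poly k\<close>.  There are \<open>25\<close> possible pairs of leading coefficients and \<open>26\<close>
  values of \<open>m\<close> to go through.
\<close>

lemma quadratic_factor_nat:
  fixes k m p s q r :: nat
  assumes k: "1 \<le> k" "k \<le> 5"
    and e: "m + s = 25" "p + m * s + q = 50 * k" "r + m * q + p * s = 35 * k\<^sup>2"
      "m * r + p * q = 10 * k^3" "p * r = k^4"
  shows "k = 4 \<and> m = 12 \<and> p = 16"
proof -
  have "m \<le> 25" using e(1) by simp
  then have m: "m \<in> {..25}" by simp
  have s: "s = 25 - m" using e(1) by simp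
  have "\<forall>(k, p, r)\<in>fourth_power_factorizations. \<forall>m\<in>{..25}. \<forall>q.
     p + m * (25 - m) + q = 50 * k \<longrightarrow> m * r + p * q = 10 * k ^ 3 \<longrightarrow>
     r + m * q + p * (25 - m) = 35 * k\<^sup>2 \<longrightarrow> k = 4 \<and> m = 12 \<and> p = 16"
    unfolding fourth_power_factorizations_def by (simp add: atMost_nat_numeral atMost_Suc)
  then show ?thesis
    using mem_fourth_power_factorizations[OF k e(5)] m e(2-4) unfolding s by blast
qed

text \<open>
  The properties of independence polynomials that the factorization argument needs.
\<close>

definition counting_poly :: "complex poly \<Rightarrow> bool" where
  "counting_poly P \<longleftrightarrow> coeff P 0 = 1 \<and> range (coeff P) \<subseteq> \<nat>"

lemma Nats_sum: "(\<And>x. x \<in> A \<Longrightarrow> f x \<in> \<nat>) \<Longrightarrow> sum f A \<in> \<nat>"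
  by (induction A rule: infinite_finite_induct) auto

lemma counting_poly_1: "counting_poly 1"
  by (auto simp: counting_poly_def coeff_1)

lemma counting_poly_mult: "counting_poly P \<Longrightarrow> counting_poly Q \<Longrightarrow> counting_poly (P * Q)"
  by (auto simp: counting_poly_def coeff_mult image_subset_iff intro!: Nats_sum Nats_mult)

lemma counting_poly_prod_mset: "(\<And>P. P \<in># M \<Longrightarrow> counting_poly P) \<Longrightarrow> counting_poly (prod_mset M)"
  by (induction M) (auto simp: counting_poly_1 counting_poly_mult)

lemma counting_poly_coeff: "counting_poly P \<Longrightarrow> \<exists>c. coeff P j = complex_of_nat c"
  by (auto simp: counting_poly_def image_subset_iff Nats_def)

lemma counting_poly_indep_poly: "finite (verts G) \<Longrightarrow> counting_poly (indep_poly G)"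
  by (auto simp: counting_poly_def coeff_indep_poly)

lemma linear_factor:
  assumes k: "1 \<le> k" "k \<le> 5" and PQ: "counting_poly P" "counting_poly Q"
    and eq: "P * Q = segment_indep_poly k" and deg: "degree P = 1"
  shows "k \<le> 4" "P = [:1, 1:]"
    "Q = [:1, 24, of_nat (50 * k) - 24, of_nat (35 * k\<^sup>2) - of_nat (50 * k) + 24, of_nat (k ^ 4):]"
proof -
  have nz: "P \<noteq> 0" "Q \<noteq> 0" using PQ by (auto simp: counting_poly_def)
  have "degree P + degree Q = 5"
    using arg_cong[OF eq, of degree] nz k by (simp add: degree_mult_eq degree_segment_indep_poly)
  then have degQ: "degree Q = 4" using deg by simp
  obtain m where m: "coeff P 1 = of_nat m" using counting_poly_coeff PQ by blast
  have P: "P = [:1, of_nat m:]"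
    using deg PQ m
    by (intro poly_eqI) (auto simp: counting_poly_def coeff_pCons coeff_eq_0 split: nat.splits)
  obtain a where a: "coeff Q 1 = of_nat a" using counting_poly_coeff PQ by blast
  obtain b where b: "coeff Q 2 = of_nat b" using counting_poly_coeff PQ by blast
  obtain c where c: "coeff Q 3 = of_nat c" using counting_poly_coeff PQ by blast
  obtain d where d: "coeff Q 4 = of_nat d" using counting_poly_coeff PQ by blast
  have Q: "Q = [:1, of_nat a, of_nat b, of_nat c, of_nat d:]"
    using degQ PQ a b c d
    by (intro poly_eqI)
      (auto simp: counting_poly_def coeff_pCons coeff_eq_0 eval_nat_numeral split: nat.splits)
  have "of_nat (m + a) = complex_of_nat 25"
    "of_nat (m * a + b) = complex_of_nat (50 * k)" "of_nat (m * b + c) = complex_of_nat (35 * k\<^sup>2)"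
    "of_nat (m * c + d) = complex_of_nat (10 * k ^ 3)" "of_nat (m * d) = complex_of_nat (k ^ 4)"
    using eq unfolding P Q segment_indep_poly_def by (auto simp: algebra_simps)
  note e = this[unfolded of_nat_eq_iff]
  have mk: "m = 1 \<and> k \<le> 4" using k e by (rule linear_factor_nat)
  then show "k \<le> 4" "P = [:1, 1:]" by (auto simp: P)
  have "of_nat a = (24 :: complex)" "of_nat b = complex_of_nat (50 * k) - 24"
    "of_nat c = of_nat (35 * k\<^sup>2) - complex_of_nat (50 * k) + 24" "of_nat d = complex_of_nat (k ^ 4)"
    using mk e(1) by (auto simp flip: e(2-5))
  then show "Q = [:1, 24, of_nat (50 * k) - 24, of_nat (35 * k\<^sup>2) - of_nat (50 * k) + 24, of_nat (k ^ 4):]"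
    by (simp add: Q)
qed

lemma quadratic_factor:
  assumes k: "1 \<le> k" "k \<le> 5" and PQ: "counting_poly P" "counting_poly Q"
    and eq: "P * Q = segment_indep_poly k" and deg: "degree P = 2"
  shows "k = 4" "P = [:1, 12, 16:]" "Q = [:1, 13, 28, 16:]"
proof -
  have nz: "P \<noteq> 0" "Q \<noteq> 0" using PQ by (auto simp: counting_poly_def)
  have "degree P + degree Q = 5"
    using arg_cong[OF eq, of degree] nz k by (simp add: degree_mult_eq degree_segment_indep_poly)
  then have degQ: "degree Q = 3" using deg by simp
  obtain m where m: "coeff P 1 = of_nat m" using counting_poly_coeff PQ by blast
  obtain p where p: "coeff P 2 = of_nat p" using counting_poly_coeff PQ by blast
  have P: "P = [:1, of_nat m, of_nat p:]"
    using deg PQ m p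
    by (intro poly_eqI)
      (auto simp: counting_poly_def coeff_pCons coeff_eq_0 eval_nat_numeral split: nat.splits)
  obtain s where s: "coeff Q 1 = of_nat s" using counting_poly_coeff PQ by blast
  obtain q where q: "coeff Q 2 = of_nat q" using counting_poly_coeff PQ by blast
  obtain r where r: "coeff Q 3 = of_nat r" using counting_poly_coeff PQ by blast
  have Q: "Q = [:1, of_nat s, of_nat q, of_nat r:]"
    using degQ PQ s q r
    by (intro poly_eqI)
      (auto simp: counting_poly_def coeff_pCons coeff_eq_0 eval_nat_numeral split: nat.splits)
  have "of_nat (m + s) = complex_of_nat 25"
    "of_nat (p + m * s + q) = complex_of_nat (50 * k)"
    "of_nat (r + m * q + p * s) = complex_of_nat (35 * k\<^sup>2)"
    "of_nat (m * r + p * q) = complex_of_nat (10 * k ^ 3)" "of_nat (p * r) = complex_of_nat (k ^ 4)"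
    using eq unfolding P Q segment_indep_poly_def by (auto simp: algebra_simps)
  note e = this[unfolded of_nat_eq_iff]
  have kmp: "k = 4 \<and> m = 12 \<and> p = 16" using k e by (rule quadratic_factor_nat)
  then have "s = 13 \<and> q = 28 \<and> r = 16" using e by simp
  then show "k = 4" "P = [:1, 12, 16:]" "Q = [:1, 13, 28, 16:]"
    using kmp by (auto simp: P Q)
qed

text \<open>
  Every factor that is not linear has degree at least two.
\<close>

lemma sum_degree_ge:
  fixes M :: "'a::zero poly multiset"
  assumes "\<And>P. P \<in># M \<Longrightarrow> degree P > 0"
  shows "2 * size M \<le> (\<Sum>P\<in>#M. degree P) + size {#P \<in># M. degree P = 1#}"
  using assms by (induction M) (auto, fastforce)

lemma degree_prod_mset:
  fixes M :: "'a::idom poly multiset"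
  shows "0 \<notin># M \<Longrightarrow> degree (prod_mset M) = (\<Sum>P\<in>#M. degree P)"
  by (induction M) (auto simp: degree_mult_eq prod_mset_zero_iff)

text \<open>
  Two linear factors would both be \<open>1 + z\<close>, and \<open>(1 + z)\<^sup>2\<close> differs from the only possible quadratic factor
  \<open>1 + 12 z + 16 z\<^sup>2\<close>.  With at most one linear factor, the total degree \<open>5\<close> leaves the degree patterns
  \<open>1 + 2 + 2\<close>, \<open>1 + 4\<close> and \<open>2 + 3\<close> for two or more factors, and the factors are then known.
\<close>

theorem factorizations_of_segment_indep_poly:
  assumes k: "1 \<le> k" "k \<le> 5" and M: "prod_mset M = segment_indep_poly k"
    and count: "\<And>P. P \<in># M \<Longrightarrow> counting_poly P" and pos: "\<And>P. P \<in># M \<Longrightarrow> degree P > 0"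
  shows "size M \<le> 3"
    and "size M = 3 \<Longrightarrow> M = {#[:1, 1:], [:1, 12, 16:], [:1, 12, 16:]#}"
    and "size M = 2 \<Longrightarrow> M = {#[:1, 12, 16:], [:1, 13, 28, 16:]#} \<or>
      k \<le> 4 \<and> M = {#[:1, 1:], [:1, 24, of_nat (50 * k) - 24,
          of_nat (35 * k\<^sup>2) - of_nat (50 * k) + 24, of_nat (k ^ 4):]#}"
proof -
  have c: "counting_poly (prod_mset N)" if "N \<subseteq># M" for N
    using count mset_subset_eqD[OF that] by (intro counting_poly_prod_mset) blast
  have split: "P * prod_mset (M - {#P#}) = segment_indep_poly k \<and> counting_poly (prod_mset (M - {#P#}))"
    if "P \<in># M" for P
    using that M c by (metis diff_subset_eq_self insert_DiffM prod_mset.add_mset)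
  have "(\<Sum>P\<in>#M. degree P) = degree (prod_mset M)"
    using pos by (intro degree_prod_mset[symmetric]) (metis degree_0 less_irrefl)
  then have sum: "(\<Sum>P\<in>#M. degree P) = 5"
    using k by (simp add: M degree_segment_indep_poly)
  have lin: "P = [:1, 1:]" if "P \<in># M" "degree P = 1" for P
    using linear_factor(2)[OF k count[OF that(1)] _ _ that(2)] split[OF that(1)] by blast
  have quad: "k = 4 \<and> P = [:1, 12, 16:] \<and> prod_mset (M - {#P#}) = [:1, 13, 28, 16:]"
    if "P \<in># M" "degree P = 2" for P
    using quadratic_factor[OF k count[OF that(1)] _ _ that(2)] split[OF that(1)] by blast
  have not_two_linear: "size {#P \<in># M. degree P = 1#} \<le> 1"
  proof (rule ccontr)
    assume "\<not> ?thesis"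
    then obtain n where "size {#P \<in># M. degree P = 1#} = Suc (Suc n)"
      by (metis One_nat_def Suc_leI not_less_eq_eq le_Suc_ex add_Suc)
    then obtain P Q N where N: "{#P \<in># M. degree P = 1#} = {#P, Q#} + N"
      by (auto elim!: size_mset_SucE)
    then have "P \<in># {#P \<in># M. degree P = 1#}" "Q \<in># {#P \<in># M. degree P = 1#}" by auto
    then have "P = [:1, 1:]" "Q = [:1, 1:]" using lin by auto
    then have sub: "{#[:1, 1:], [:1, 1:]#} \<subseteq># M"
      using N multiset_filter_subset[of "\<lambda>P. degree P = 1" M]
      by (metis mset_subset_eq_add_left subset_mset.order_trans)
    let ?N = "M - {#[:1, 1:], [:1, 1:]#}"
    have "[:1, 2, 1:] * prod_mset ?N = segment_indep_poly k"
    proof -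
      have "prod_mset M = prod_mset {#[:1, 1:], [:1, 1:] :: complex poly#} * prod_mset ?N"
        using sub by (metis prod_mset.union subset_mset.add_diff_inverse)
      then show ?thesis unfolding M by simp
    qed
    moreover have "counting_poly [:1, 2, 1:]"
      using counting_poly_mult[of "[:1, 1:]" "[:1, 1:]"] by (auto simp: counting_poly_def coeff_pCons split: nat.splits)
    ultimately have "[:1, 2, 1:] = [:1, 12, 16 :: complex:]"
      by (intro quadratic_factor(2)[OF k _ c[of ?N]]) auto
    then show False by simp
  qed
  then show "size M \<le> 3"
    using sum_degree_ge[of M] pos sum by fastforce
  show "M = {#[:1, 1:], [:1, 12, 16:], [:1, 12, 16:]#}" if "size M = 3"
  proof -
    have "size {#P \<in># M. degree P = 1#} > 0"
      using sum_degree_ge[of M, OF pos] sum that by linarith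
    then obtain L where "L \<in># {#P \<in># M. degree P = 1#}"
      by (metis multiset_nonemptyE size_empty less_irrefl)
    then have L: "L \<in># M" "degree L = 1" by auto
    from L(1) obtain N where N: "M = add_mset L N" by (rule mset_add)
    then have "size N = Suc (Suc 0)" using \<open>size M = 3\<close> by simp
    then obtain P Q where M': "M = {#L, P, Q#}" unfolding N by (auto elim!: size_mset_SucE)
    have "degree P = 2" "degree Q = 2"
      using sum L not_two_linear pos[of P] pos[of Q] by (auto simp: M' split: if_splits)
    then show ?thesis
      using lin[of L] L quad[of P] quad[of Q] by (simp add: M')
  qed
  show "M = {#[:1, 12, 16:], [:1, 13, 28, 16:]#} \<or>
      k \<le> 4 \<and> M = {#[:1, 1:], [:1, 24, of_nat (50 * k) - 24,
          of_nat (35 * k\<^sup>2) - of_nat (50 * k) + 24, of_nat (k ^ 4):]#}" if size: "size M = 2"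
  proof -
    obtain P' Q' where "M = {#P', Q'#}"
      using size by (auto simp: numeral_2_eq_2 elim!: size_mset_SucE)
    then obtain P Q where M': "M = {#P, Q#}" and le: "degree P \<le> degree Q"
      by (metis add_mset_commute nat_le_linear)
    have "degree P = 1 \<or> degree P = 2"
      using sum le pos[of P] by (auto simp: M')
    then show ?thesis
    proof
      assume "degree P = 1"
      then show ?thesis
        using linear_factor[OF k count[of P] count[of Q]] split[of P] by (simp add: M')
    next
      assume "degree P = 2"
      then show ?thesis using quad[of P] by (simp add: M')
    qed
  qed
qed

section \<open>Decompositions and attractors\<close>

theorem proposition3p1:
  fixes G :: "('a, 'b) pre_digraph" and A :: "complex set"
  assumes "graph G"
    and "\<not> Digraph_Component.connected G"
    and "independence_number G = 5"
    and "has_independence_attractor G A"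
    and "\<exists>a b. a \<noteq> b \<and> A = closed_segment a b"
  shows "card (pre_digraph.sccs G) \<le> 3
    \<and> (card (pre_digraph.sccs G) = 3 \<longrightarrow>
         indep_decomposition G {# [:1, 1:], [:1, 12, 16:], [:1, 12, 16:] #})
    \<and> (card (pre_digraph.sccs G) = 2 \<longrightarrow>
         indep_decomposition G {# [:1, 12, 16:], [:1, 13, 28, 16:] #}
       \<or> indep_decomposition G {# [:1, 1:], [:1, 24, 26, 9, 1:] #}
       \<or> indep_decomposition G {# [:1, 1:], [:1, 24, 76, 64, 16:] #}
       \<or> indep_decomposition G {# [:1, 1:], [:1, 24, 126, 189, 81:] #}
       \<or> indep_decomposition G {# [:1, 1:], [:1, 24, 176, 384, 256:] #})
    \<and> (indep_decomposition G {# [:1, 1:], [:1, 12, 16:], [:1, 12, 16:] #}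
       \<or> indep_decomposition G {# [:1, 12, 16:], [:1, 13, 28, 16:] #}
       \<or> indep_decomposition G {# [:1, 1:], [:1, 24, 176, 384, 256:] #}
         \<longrightarrow> A = complex_of_real ` {-1..0})
    \<and> (indep_decomposition G {# [:1, 1:], [:1, 24, 76, 64, 16:] #}
         \<longrightarrow> A = complex_of_real ` {-2..0})
    \<and> (indep_decomposition G {# [:1, 1:], [:1, 24, 126, 189, 81:] #}
         \<longrightarrow> A = complex_of_real ` {-(4/3)..0})
    \<and> (indep_decomposition G {# [:1, 1:], [:1, 24, 26, 9, 1:] #}
         \<longrightarrow> A = complex_of_real ` {-4..0})"
proof -
  interpret graph G by (rule assms(1))
  obtain k where k: "1 \<le> k" "k \<le> 5" "indep_poly G = segment_indep_poly k"
    and A: "A = complex_of_real ` {-(4 / real k)..0}"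
    using indep_poly_if_segment_attractor[OF assms(1,3,4)] assms(5) by blast
  define M where "M = image_mset indep_poly (mset_set sccs)"
  have dec: "indep_decomposition G M"
    unfolding M_def by (rule indep_decomposition_components)
  then have prod: "prod_mset M = segment_indep_poly k"
    using k(3) by (simp add: indep_decomposition_def)
  have size: "size M = card sccs" by (simp add: M_def)
  have comp: "counting_poly P \<and> degree P > 0" if P: "P \<in># M" for P
  proof -
    obtain H where H: "H \<in> sccs" "P = indep_poly H"
      using P finite_sccs by (auto simp: M_def)
    then have "verts H \<noteq> {}" by (auto simp: sccs_def strongly_connected_def)
    then show ?thesis
      using finite_verts_scc[OF H(1)] H(2)
      by (simp add: counting_poly_indep_poly degree_indep_poly independence_number_pos)
  qed
  note fact = factorizations_of_segment_indep_poly[OF k(1,2) prod, unfolded size]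
  have "card sccs \<le> 3" by (rule fact(1)) (use comp in simp_all)
  moreover have "indep_decomposition G {# [:1, 1:], [:1, 12, 16:], [:1, 12, 16:] #}"
    if "card sccs = 3"
  proof -
    have "M = {# [:1, 1:], [:1, 12, 16:], [:1, 12, 16:] #}"
      by (rule fact(2)) (use comp that in simp_all)
    then show ?thesis using dec by simp
  qed
  moreover have "indep_decomposition G {# [:1, 12, 16:], [:1, 13, 28, 16:] #}
       \<or> indep_decomposition G {# [:1, 1:], [:1, 24, 26, 9, 1:] #}
       \<or> indep_decomposition G {# [:1, 1:], [:1, 24, 76, 64, 16:] #}
       \<or> indep_decomposition G {# [:1, 1:], [:1, 24, 126, 189, 81:] #}
       \<or> indep_decomposition G {# [:1, 1:], [:1, 24, 176, 384, 256:] #}" if "card sccs = 2"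
  proof -
    have "M = {#[:1, 12, 16:], [:1, 13, 28, 16:]#} \<or>
      k \<le> 4 \<and> M = {#[:1, 1:], [:1, 24, of_nat (50 * k) - 24,
          of_nat (35 * k\<^sup>2) - of_nat (50 * k) + 24, of_nat (k ^ 4):]#}"
      by (rule fact(3)) (use comp that in simp_all)
    then consider "M = {#[:1, 12, 16:], [:1, 13, 28, 16:]#}"
      | "k \<le> 4" "M = {#[:1, 1:], [:1, 24, of_nat (50 * k) - 24,
          of_nat (35 * k\<^sup>2) - of_nat (50 * k) + 24, of_nat (k ^ 4):]#}"
      by blast
    then show ?thesis
    proof cases
      case 2
      consider "k = 1" | "k = 2" | "k = 3" | "k = 4" using k(1) 2(1) by linarith
      then show ?thesis using dec unfolding 2(2) by cases simp_all
    qed (use dec in simp)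
  qed
  moreover have "k = l" if "indep_decomposition G N" "prod_mset N = segment_indep_poly l" for N l
    using that k(3) by (simp add: indep_decomposition_def segment_indep_poly_inject)
  \<comment> \<open>A decomposition determines the coefficient \<open>50 k\<close> of \<open>z\<^sup>2\<close>, hence the left endpoint \<open>-4/k\<close>.\<close>
  note determined = this[of _ 1] this[of _ 2] this[of _ 3] this[of _ 4]
  moreover have "A = complex_of_real ` {-1..0}"
    if "indep_decomposition G {# [:1, 1:], [:1, 12, 16:], [:1, 12, 16:] #}
       \<or> indep_decomposition G {# [:1, 12, 16:], [:1, 13, 28, 16:] #}
       \<or> indep_decomposition G {# [:1, 1:], [:1, 24, 176, 384, 256:] #}"
  proof -
    have "k = 4"
      using that by (elim disjE) (erule determined(4), simp add: segment_indep_poly_def)+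
    then show ?thesis using A by simp
  qed
  moreover have "A = complex_of_real ` {-2..0}"
    if "indep_decomposition G {# [:1, 1:], [:1, 24, 76, 64, 16:] #}"
    using determined(2)[OF that] A by (simp add: segment_indep_poly_def)
  moreover have "A = complex_of_real ` {-(4/3)..0}"
    if "indep_decomposition G {# [:1, 1:], [:1, 24, 126, 189, 81:] #}"
    using determined(3)[OF that] A by (simp add: segment_indep_poly_def)
  moreover have "A = complex_of_real ` {-4..0}"
    if "indep_decomposition G {# [:1, 1:], [:1, 24, 26, 9, 1:] #}"
    using determined(1)[OF that] A by (simp add: segment_indep_poly_def)
  ultimately show ?thesis by blast
qed

end
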